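(* Let $S$ be the set of squarefree natural numbers and $S(x)=\{n\in S: n\le x\}$. Suppose $g:S\to\mathbb{R}$ is additive (i.e. $g(nm)=g(n)+g(m)$ whenever $n,m\in S$ are coprime) with $|g(p)|\le 1$ for every prime $p$. Let $$A(x)=\sum_{p\le x}\frac{g(p)}{p},\qquad B(x)=\sqrt{\sum_{p\le x}\frac{g(p)^2}{p}},$$ the sums being over primes $p\le x$. If $B(x)/\log\log\log x\to\infty$ as $x\to\infty$, then for every real $z$, $$\frac{|\{n\in S(x): g(n)-A(x)\le zB(x)\}|}{|S(x)|}\longrightarrow G(z):=\frac{1}{\sqrt{2\pi}}\int_{-\infty}^{z}e^{-w^2/2}\,\mathrm{d}w \quad (x\to\infty).$$ *)

theory Defs
  imports "HOL-Analysis.Analysis" "HOL-Computational_Algebra.Squarefree"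
begin

(* 0 is not squarefree in the library, so every element is positive. *)
definition sqfree_nats :: "nat set" where
  "sqfree_nats = {n. squarefree n}"

definition sqfree_upto :: "real \<Rightarrow> nat set" where
  "sqfree_upto x = {n \<in> sqfree_nats. real n \<le> x}"

(* A function on the squarefree numbers is represented by a total function on nat
   whose values outside sqfree_nats are unconstrained and never used. *)
definition additive_on_sqfree :: "(nat \<Rightarrow> real) \<Rightarrow> bool" where
  "additive_on_sqfree g \<longleftrightarrow>
     (\<forall>n\<in>sqfree_nats. \<forall>m\<in>sqfree_nats. coprime n m \<longrightarrow> g (n * m) = g n + g m)"

definition prime_mean :: "(nat \<Rightarrow> real) \<Rightarrow> real \<Rightarrow> real" where
  "prime_mean g x = (\<Sum>p | prime p \<and> real p \<le> x. g p / real p)"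

definition prime_dev :: "(nat \<Rightarrow> real) \<Rightarrow> real \<Rightarrow> real" where
  "prime_dev g x = sqrt (\<Sum>p | prime p \<and> real p \<le> x. (g p)\<^sup>2 / real p)"

definition gauss_cdf :: "real \<Rightarrow> real" where
  "gauss_cdf z = 1 / sqrt (2 * pi) * (LINT w:{..z}|lborel. exp (- (w\<^sup>2 / 2)))"

end

theory Submission
  imports Defs "HOL-Probability.Levy" "HOL-Probability.Probability_Mass_Function"
    "HOL-Real_Asymp.Real_Asymp"
begin

text \<open>
  Put \<open>u = ln ln ln x\<close> and \<open>y = x powr (1/u)\<close>. A number up to \<open>x\<close> has at most \<open>u\<close> prime factors
  above \<open>y\<close>, so by double counting the sum of \<open>1/p\<close> over \<open>y < p \<le> x\<close> is at most \<open>u + 1\<close>. Since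
  \<open>u = o(B)\<close>, the primes above \<open>y\<close> are negligible, without any appeal to Mertens' theorems.
  For the primes up to \<open>y\<close>, divisibility of a random squarefree number is compared with independent
  events of probability \<open>1/(p+1)\<close>: mixed moments of fixed order differ by \<open>O(1 / sqrt x)\<close>, and there are
  only \<open>y powr O(1) = x powr o(1)\<close> of them. A Taylor expansion whose remainder is controlled by the
  exponential moments of the independent model turns this into closeness of characteristic functions;
  those of the independent model converge to \<open>exp (-t\<^sup>2/2)\<close>, and Levy's continuity theorem applies.
\<close>

section \<open>Squarefree numbers with prescribed prime divisors\<close>

text \<open>The cutoff has to meet two opposing demands. Comparing moments of order at most
  \<open>2 * m\<close> costs about \<open>y ^ (2 * m) / sqrt x\<close>, which vanishes for every
  fixed \<open>m\<close> because \<open>u\<close> tends to infinity. The primes above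
  \<open>y\<close> shift both \<open>g n\<close> and its mean by O(u), which disappears after
  division by \<open>B\<close> because \<open>u = o(B)\<close>. The probability 1/(p+1) is the
  density of the multiples of p among squarefree numbers, (1/p - 1/p^2) / (1 - 1/p^2). The limits
  are taken in a fixed order: x grows with \<open>m\<close> held fixed, leaving a Taylor tail of
  size \<open>4 * (1 / 4) ^ m * exp (4 * t\<^sup>2)\<close> that is free of x, and \<open>m\<close>
  is chosen to make that tail small. This requires a frequency error with a power saving in x that
  is uniform over all sets of at most \<open>2 * m\<close> primes, so the squarefree multiples are
  counted with a constant depending only on the number of primes.\<close>

definition moebius_mu :: "nat \<Rightarrow> real" where
  "moebius_mu d = (if squarefree d then (-1) ^ card (prime_factors d) else 0)"

lemma abs_mu_le: "\<bar>moebius_mu d\<bar> \<le> 1"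
  by (simp add: moebius_mu_def)

lemma prod_subset_prime_factors_dvd:
  fixes s :: nat
  assumes "s > 0" "T \<subseteq> prime_factors s"
  shows "\<Prod>T dvd s"
proof -
  let ?P = "prime_factors s"
  have "\<Prod>T dvd \<Prod>?P" using assms by (intro prod_dvd_prod_subset) auto
  also have "\<Prod>?P dvd (\<Prod>p\<in>?P. p ^ multiplicity p s)"
    by (intro prod_dvd_prod) (auto intro!: dvd_power simp: prime_factors_multiplicity)
  also have "\<dots> = s" using assms by (simp add: prod_prime_factors)
  finally show ?thesis .
qed

lemma squarefree_prod_primes:
  fixes T :: "nat set"
  assumes "\<And>p. p \<in> T \<Longrightarrow> prime p"
  shows "squarefree (\<Prod>T)"
  using assms by (intro squarefree_prod_coprime) (auto intro!: primes_coprime squarefree_prime)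

lemma prime_factors_prod_primes:
  fixes T :: "nat set"
  assumes "finite T" "\<And>p. p \<in> T \<Longrightarrow> prime p"
  shows "prime_factors (\<Prod>T) = T"
proof -
  have "0 \<notin> (\<lambda>x. x) ` T" using assms not_prime_0 by (metis imageE)
  hence "prime_factors (\<Prod>T) = (\<Union>p\<in>T. prime_factors p)"
    using prime_factors_prod[OF assms(1), of "\<lambda>x. x"] by (simp add: o_def)
  also have "\<dots> = (\<Union>p\<in>T. {p})"
    by (intro SUP_cong refl) (simp add: assms prime_prime_factors)
  also have "\<dots> = T" by simp
  finally show ?thesis .
qed

lemma squarefree_eq_prod_prime_factors:
  fixes d :: nat
  assumes "squarefree d"
  shows "\<Prod>(prime_factors d) = d"
proof -
  have "d > 0" using assms by (cases d) auto
  have "(\<Prod>p\<in>prime_factors d. p ^ multiplicity p d) = \<Prod>(prime_factors d)"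
    using assms squarefree_factorial_semiring'[of d] \<open>d > 0\<close>
    by (intro prod.cong) (auto simp: in_prime_factors_iff)
  thus ?thesis using \<open>d > 0\<close> by (simp add: prod_prime_factors)
qed

text \<open>Only squarefree divisors contribute, and these are the products over subsets of the
  prime factors. The signed sum over subsets factors as a product of \<open>1 - 1\<close>, which is
  an empty product exactly for \<open>s = 1\<close>.\<close>

lemma sum_mu_divisors:
  assumes "s > 0"
  shows "(\<Sum>d | d dvd s. moebius_mu d) = of_bool (s = 1)"
proof -
  let ?P = "prime_factors s"
  have pr: "finite T" "\<And>p. p \<in> T \<Longrightarrow> prime p" if "T \<subseteq> ?P" for T
    using that by (auto intro: finite_subset)
  have "(\<Sum>d | d dvd s. moebius_mu d) = (\<Sum>d | d dvd s \<and> squarefree d. (-1) ^ card (prime_factors d))"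
    using assms by (intro sum.mono_neutral_cong_right) (auto simp: moebius_mu_def)
  also have "\<dots> = (\<Sum>T\<in>Pow ?P. (-1) ^ card T)"
    by (rule sum.reindex_bij_witness[of _ "\<lambda>T. \<Prod>T" prime_factors])
       (use assms pr dvd_prime_factors[of s] in \<open>auto simp: prime_factors_prod_primes
          squarefree_prod_primes squarefree_eq_prod_prime_factors prod_subset_prime_factors_dvd\<close>)
  also have "\<dots> = (\<Prod>p\<in>?P. 1 - 1 :: real)"
    by (subst prod_diff_conv_sum) auto
  also have "\<dots> = of_bool (s = 1)"
    using assms by (auto simp: prime_factorization_empty_iff card_eq_0_iff power_0_left)
  finally show ?thesis .
qed

text \<open>\<open>d ^ 2 dvd n\<close> means that \<open>d\<close> divides the square part of
  \<open>n\<close>, so this is the ordinary Moebius sum at \<open>square_part n\<close>, which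
  equals 1 precisely for squarefree \<open>n\<close>.\<close>

lemma sum_mu_square_divisors:
  fixes n :: nat
  assumes "n > 0"
  shows "(\<Sum>d | d ^ 2 dvd n. moebius_mu d) = of_bool (squarefree n)"
proof -
  have "square_part n = 1 \<longleftrightarrow> squarefree n"
  proof
    assume "square_part n = 1"
    thus "squarefree n" by (auto simp: squarefree_def simp flip: dvd_square_part_iff)
  next
    assume "squarefree n"
    thus "square_part n = 1" using squarefreeD[OF _ square_part_square_dvd[of n]] by simp
  qed
  moreover have "square_part n > 0" using assms square_part_0_iff[of n] by (cases "square_part n") auto
  ultimately show ?thesis
    using sum_mu_divisors[of "square_part n"] by (simp add: dvd_square_part_iff)
qed

section \<open>Counting squarefree numbers, with and without prescribed prime divisors\<close>

lemma card_multiples_atLeastAtMost: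
  assumes "k > (0::nat)"
  shows "card {n \<in> {1..N}. k dvd n} = N div k"
proof -
  have "{n \<in> {1..N}. k dvd n} = (\<lambda>m. k * m) ` {1..N div k}"
    using assms by (auto elim!: dvdE simp: less_eq_div_iff_mult_less_eq mult.commute Suc_le_eq)
  also have "card \<dots> = N div k"
    using assms by (subst card_image) (auto simp: inj_on_def)
  finally show ?thesis .
qed

lemma abs_floor_div_diff_le:
  fixes x :: real
  assumes "x \<ge> 0" "k > (0::nat)"
  shows "\<bar>real (nat \<lfloor>x\<rfloor> div k) - x / real k\<bar> \<le> 1"
proof -
  have "real (nat \<lfloor>x\<rfloor> div k) = of_int \<lfloor>x / real k\<rfloor>"
  proof -
    have "int (nat \<lfloor>x\<rfloor> div k) = \<lfloor>x\<rfloor> div int k" using assms by (simp add: zdiv_int)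
    also have "\<dots> = \<lfloor>x / real k\<rfloor>" using floor_divide_real_eq_div[of "int k" x] by simp
    finally show ?thesis by (simp only: of_int_of_nat_eq flip: of_int_eq_iff[where 'a = real])
  qed
  thus ?thesis by linarith
qed

text \<open>Telescoping with the majorant \<open>2 / m - 2 / (m + 1)\<close> of
  \<open>1 / m ^ 2\<close>; the factor 2 makes it valid from \<open>m = 1\<close> on, so
  \<open>N = 0\<close> is covered. Since \<open>1 / 0 = 0\<close>, the hypothesis forces
  \<open>f 0 = 0\<close>.\<close>

lemma suminf_inverse_squares_tail:
  fixes f :: "nat \<Rightarrow> real"
  assumes "\<And>n. \<bar>f n\<bar> \<le> 1 / real n ^ 2"
  shows "summable f" and "\<bar>suminf f - (\<Sum>d\<le>N. f d)\<bar> \<le> 2 / real (Suc N)"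
proof -
  have tele: "(\<lambda>n. 2 / real (n + Suc N) - 2 / real (Suc n + Suc N)) sums (2 / real (0 + Suc N) - 0)"
    by (intro telescope_sums') real_asymp
  have le: "\<bar>f (n + Suc N)\<bar> \<le> 2 / real (n + Suc N) - 2 / real (Suc n + Suc N)" for n
  proof -
    define m where "m = real (n + Suc N)"
    have m: "m \<ge> 1" by (simp add: m_def)
    have "\<bar>f (n + Suc N)\<bar> \<le> 1 / m ^ 2" unfolding m_def by (rule assms)
    also have "\<dots> \<le> 2 / m - 2 / (m + 1)"
    proof -
      have "1 / m ^ 2 = 2 / (m * (m + m))" using m by (simp add: field_simps power2_eq_square)
      also have "\<dots> \<le> 2 / (m * (m + 1))"
        using m by (intro divide_left_mono mult_left_mono) auto
      also have "\<dots> = 2 / m - 2 / (m + 1)" using m by (simp add: field_simps)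
      finally show ?thesis .
    qed
    finally show ?thesis by (simp add: m_def add_ac)
  qed
  have smabs: "summable (\<lambda>n. \<bar>f (n + Suc N)\<bar>)"
    by (rule summable_comparison_test_ev[OF _ sums_summable[OF tele]]) (use le in auto)
  hence sm: "summable (\<lambda>n. f (n + Suc N))" by (rule summable_rabs_cancel)
  thus "summable f" by (rule summable_iff_shift[THEN iffD1])
  hence "suminf f - (\<Sum>d\<le>N. f d) = (\<Sum>n. f (n + Suc N))"
    using suminf_minus_initial_segment[of f "Suc N"] by (simp add: lessThan_Suc_atMost)
  also have "\<bar>\<dots>\<bar> \<le> (\<Sum>n. \<bar>f (n + Suc N)\<bar>)" by (rule summable_rabs[OF smabs])
  also have "\<dots> \<le> (\<Sum>n. 2 / real (n + Suc N) - 2 / real (Suc n + Suc N))"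
    by (rule suminf_le[OF le smabs sums_summable[OF tele]])
  also have "\<dots> = 2 / real (Suc N)" using sums_unique[OF tele] by simp
  finally show "\<bar>suminf f - (\<Sum>d\<le>N. f d)\<bar> \<le> 2 / real (Suc N)" .
qed

text \<open>The value is \<open>6 / pi\<^sup>2\<close>; only its positivity matters.\<close>

definition sqfree_density :: real where
  "sqfree_density = (\<Sum>d. moebius_mu d / real d ^ 2)"

lemma abs_mu_div_le: "\<bar>moebius_mu d / real d ^ 2\<bar> \<le> 1 / real d ^ 2"
  using abs_mu_le[of d] by (simp add: abs_divide divide_right_mono)

text \<open>The terms up to 2 sum to at least 3/4, while the tail beyond them is at most 2/3.
  Stopping at 1 would only give a bound from below by 0.\<close>

lemma sqfree_density_pos: "sqfree_density > 0"
proof -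
  have "\<bar>sqfree_density - (\<Sum>d\<le>2. moebius_mu d / real d ^ 2)\<bar> \<le> 2 / real (Suc 2)"
    unfolding sqfree_density_def by (rule suminf_inverse_squares_tail(2)) (rule abs_mu_div_le)
  moreover have "(\<Sum>d\<le>2. moebius_mu d / real d ^ 2) = 1 + moebius_mu 2 / 4"
    by (simp add: eval_nat_numeral moebius_mu_def)
  ultimately show ?thesis using abs_mu_le[of 2] by (simp add: abs_if split: if_splits)
qed

lemma finite_sqfree_upto: "finite (sqfree_upto x)"
proof (rule finite_subset)
  show "sqfree_upto x \<subseteq> {..nat \<lfloor>x\<rfloor>}"
    by (auto simp: sqfree_upto_def le_nat_floor)
qed auto

lemma sqfree_upto_eq: "sqfree_upto x = {n \<in> {1..nat \<lfloor>x\<rfloor>}. squarefree n}"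
proof -
  have *: "n \<in> {1..nat \<lfloor>x\<rfloor>} \<longleftrightarrow> n > 0 \<and> real n \<le> x" for n
  proof (cases "n > 0")
    case True
    hence "n \<le> nat \<lfloor>x\<rfloor> \<longleftrightarrow> int n \<le> \<lfloor>x\<rfloor>" by linarith
    with True show ?thesis by (simp add: le_floor_iff)
  qed auto
  have "squarefree n \<Longrightarrow> n > 0" for n :: nat by (cases n) auto
  thus ?thesis unfolding sqfree_upto_def sqfree_nats_def using * by blast
qed

text \<open>The Moebius identity turns the count into a sum of
  \<open>moebius_mu d * (M div d ^ 2)\<close> over \<open>d \<le> sqrt x\<close>. Removing the
  floors costs at most 1 for each \<open>d\<close>; completing the series costs \<open>x\<close>
  times a tail of size \<open>2 / sqrt x\<close>. Together this is
  \<open>3 * sqrt x\<close>.\<close>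

lemma card_sqfree_upto_bound:
  assumes x: "x \<ge> 0"
  shows "\<bar>real (card (sqfree_upto x)) - sqfree_density * x\<bar> \<le> 3 * sqrt x"
proof -
  define M N where "M = nat \<lfloor>x\<rfloor>" and "N = nat \<lfloor>sqrt x\<rfloor>"
  have N: "real N \<le> sqrt x" "sqrt x < real (Suc N)"
    using x unfolding N_def by (simp_all add: of_nat_nat) linarith
  have M: "real M \<le> x" using x unfolding M_def by simp
  have dN: "d \<le> N" if "d ^ 2 dvd n" "n \<in> {1..M}" for d n
  proof -
    have "d ^ 2 \<le> n" using that by (intro dvd_imp_le) auto
    hence "real d ^ 2 \<le> x" using that M by (metis (mono_tags, opaque_lifting) atLeastAtMost_iff of_nat_le_iff of_nat_power order_trans)
    hence "real d \<le> sqrt x" by (rule real_le_rsqrt)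
    with N show ?thesis by linarith
  qed
  have "real (card (sqfree_upto x)) = (\<Sum>n\<in>{1..M}. of_bool (squarefree n))"
    by (simp add: sqfree_upto_eq M_def sum_of_bool_eq Int_def)
  also have "\<dots> = (\<Sum>n\<in>{1..M}. \<Sum>d\<in>{..N}. if d ^ 2 dvd n then moebius_mu d else 0)"
  proof (intro sum.cong refl)
    fix n assume n: "n \<in> {1..M}"
    have "of_bool (squarefree n) = (\<Sum>d | d ^ 2 dvd n. moebius_mu d)"
      using n by (subst sum_mu_square_divisors) auto
    also have "{d. d ^ 2 dvd n} = {d \<in> {..N}. d ^ 2 dvd n}" using dN[OF _ n] by auto
    also have "(\<Sum>d\<in>\<dots>. moebius_mu d) = (\<Sum>d\<in>{..N}. if d ^ 2 dvd n then moebius_mu d else 0)"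
      by (rule sum.inter_filter) simp
    finally show "of_bool (squarefree n) = \<dots>" .
  qed
  also have "\<dots> = (\<Sum>d\<le>N. moebius_mu d * real (M div d ^ 2))"
  proof (subst sum.swap, intro sum.cong refl)
    fix d
    have "(\<Sum>n\<in>{1..M}. if d ^ 2 dvd n then moebius_mu d else 0) = moebius_mu d * real (card {n \<in> {1..M}. d ^ 2 dvd n})"
      by (subst sum.inter_filter[symmetric]) auto
    thus "(\<Sum>n\<in>{1..M}. if d ^ 2 dvd n then moebius_mu d else 0) = moebius_mu d * real (M div d ^ 2)"
      \<comment> \<open>The index \<open>d = 0\<close> is harmless: 0 is not squarefree, so
        \<open>moebius_mu 0 = 0\<close>.\<close>
      by (cases "d = 0") (auto simp: card_multiples_atLeastAtMost[of "d ^ 2" M, simplified] moebius_mu_def)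
  qed
  finally have eq: "real (card (sqfree_upto x)) = (\<Sum>d\<le>N. moebius_mu d * real (M div d ^ 2))" .
  have "\<bar>real (card (sqfree_upto x)) - x * (\<Sum>d\<le>N. moebius_mu d / real d ^ 2)\<bar>
      = \<bar>\<Sum>d\<le>N. moebius_mu d * (real (M div d ^ 2) - x / real d ^ 2)\<bar>"
    unfolding eq by (simp add: sum_distrib_left sum_subtractf algebra_simps)
  also have "\<dots> \<le> (\<Sum>d\<le>N. if d = 0 then 0 else 1)"
  proof (rule order.trans[OF sum_abs], rule sum_mono)
    fix d
    show "\<bar>moebius_mu d * (real (M div d ^ 2) - x / real d ^ 2)\<bar> \<le> (if d = 0 then 0 else 1)"
      using mult_mono[OF abs_mu_le[of d] abs_floor_div_diff_le[OF x, of "d ^ 2"]]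
      by (auto simp: abs_mult moebius_mu_def M_def)
  qed
  also have "\<dots> = real N"
  proof -
    have "(\<Sum>d\<le>N. if d = 0 then 0 else 1 :: real) = (\<Sum>d\<in>{1..N}. 1)"
      by (rule sum.mono_neutral_cong_right) auto
    thus ?thesis by simp
  qed
  finally have 1: "\<bar>real (card (sqfree_upto x)) - x * (\<Sum>d\<le>N. moebius_mu d / real d ^ 2)\<bar> \<le> sqrt x"
    using N by linarith
  have "\<bar>sqfree_density - (\<Sum>d\<le>N. moebius_mu d / real d ^ 2)\<bar> \<le> 2 / real (Suc N)"
    unfolding sqfree_density_def by (rule suminf_inverse_squares_tail(2)) (rule abs_mu_div_le)
  hence "x * \<bar>sqfree_density - (\<Sum>d\<le>N. moebius_mu d / real d ^ 2)\<bar> \<le> x * (2 / real (Suc N))"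
    using x by (intro mult_left_mono)
  also have "\<dots> \<le> 2 * sqrt x"
  proof -
    have "x = sqrt x * sqrt x" using x by simp
    also have "\<dots> \<le> sqrt x * real (Suc N)" using N x by (intro mult_left_mono) auto
    finally show ?thesis by (simp add: field_simps)
  qed
  finally have "\<bar>x * sqfree_density - x * (\<Sum>d\<le>N. moebius_mu d / real d ^ 2)\<bar> \<le> 2 * sqrt x"
    using x by (simp add: abs_mult flip: right_diff_distrib)
  with 1 show ?thesis by (simp add: mult.commute abs_le_iff)
qed

text \<open>For \<open>n = p * m\<close>, squarefreeness of \<open>n\<close> means that
  \<open>m\<close> is squarefree and not divisible by \<open>p\<close>. So the first count is that
  of the \<open>m\<close> up to \<open>x / p\<close> divisible by all of \<open>D\<close> but not by
  \<open>p\<close>, and the second count restores the \<open>m\<close> divisible by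
  \<open>p\<close>.\<close>

lemma card_sqfree_upto_multiples_insert:
  assumes p: "prime p" and D: "\<forall>q\<in>D. prime q" "p \<notin> D"
  shows "card {n \<in> sqfree_upto x. \<forall>q\<in>insert p D. q dvd n}
       + card {n \<in> sqfree_upto (x / real p). \<forall>q\<in>insert p D. q dvd n}
       = card {n \<in> sqfree_upto (x / real p). \<forall>q\<in>D. q dvd n}"
proof -
  let ?A = "{n \<in> sqfree_upto (x / real p). (\<forall>q\<in>D. q dvd n) \<and> \<not> p dvd n}"
  have p0: "p > 0" using p by (simp add: prime_gt_0_nat)
  have dvd: "q dvd p * m \<longleftrightarrow> q dvd m" if "q \<in> D" for q m
    using that p D by (metis prime_dvd_mult_iff primes_dvd_imp_eq dvd_mult)
  have sq: "squarefree (p * m) \<longleftrightarrow> squarefree m \<and> \<not> p dvd m" for m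
  proof safe
    assume s: "squarefree (p * m)"
    show "squarefree m" using s by (rule squarefree_multD)
    assume "p dvd m"
    hence "p ^ 2 dvd p * m" by (simp add: power2_eq_square)
    hence "p dvd 1" using s squarefreeD by blast
    thus False using p by (simp add: prime_nat_iff)
  next
    assume "squarefree m" "\<not> p dvd m"
    thus "squarefree (p * m)"
      using p by (intro squarefree_mult_coprime) (auto simp: prime_imp_coprime squarefree_prime)
  qed
  have "{n \<in> sqfree_upto x. \<forall>q\<in>insert p D. q dvd n} = (\<lambda>m. p * m) ` ?A"
  proof safe
    fix n assume n: "n \<in> sqfree_upto x" "\<forall>q\<in>insert p D. q dvd n"
    then obtain m where m: "n = p * m" by (auto elim: dvdE)
    have "squarefree m" "\<not> p dvd m" using n sq[of m] by (auto simp: m sqfree_upto_def sqfree_nats_def)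
    moreover have "real m \<le> x / real p"
      using n p0 by (auto simp: m sqfree_upto_def field_simps)
    moreover have "\<forall>q\<in>D. q dvd m" using n dvd unfolding m by blast
    ultimately have "m \<in> ?A" by (simp add: sqfree_upto_def sqfree_nats_def)
    thus "n \<in> (\<lambda>m. p * m) ` ?A" unfolding m by blast
  next
    fix m assume m: "m \<in> sqfree_upto (x / real p)" "\<not> p dvd m"
    hence "squarefree (p * m)" unfolding sq by (simp add: sqfree_upto_def sqfree_nats_def)
    moreover have "real (p * m) \<le> x"
      using m p0 by (auto simp: sqfree_upto_def field_simps)
    ultimately show "p * m \<in> sqfree_upto x"
      by (simp add: sqfree_upto_def sqfree_nats_def)
  qed (use dvd in auto)
  moreover have "inj_on (\<lambda>m. p * m) ?A" using p0 by (auto simp: inj_on_def)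
  ultimately have "card {n \<in> sqfree_upto x. \<forall>q\<in>insert p D. q dvd n} = card ?A"
    by (simp add: card_image)
  also have "card ?A + card {n \<in> sqfree_upto (x / real p). \<forall>q\<in>insert p D. q dvd n}
      = card (?A \<union> {n \<in> sqfree_upto (x / real p). \<forall>q\<in>insert p D. q dvd n})"
    by (rule card_Un_disjoint[symmetric]) (auto intro: finite_subset[OF _ finite_sqfree_upto])
  also have "?A \<union> {n \<in> sqfree_upto (x / real p). \<forall>q\<in>insert p D. q dvd n}
      = {n \<in> sqfree_upto (x / real p). \<forall>q\<in>D. q dvd n}" by auto
  finally show ?thesis .
qed

text \<open>The main term obeys the recursion of the previous lemma exactly, because
  \<open>(1 + 1 / p) / (p + 1) = 1 / p\<close>. Hence the error at \<open>x\<close> is at most the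
  sum of the errors at \<open>x / p\<close> for \<open>D\<close> and for \<open>insert p D\<close>.
  As \<open>p \<ge> 2\<close>, the base of the power may be any \<open>a\<close> with
  \<open>(1 + a) / sqrt 2 \<le> a\<close>, and 3 is the least such integer.\<close>

lemma card_sqfree_upto_multiples_bound:
  assumes "finite D" "\<forall>p\<in>D. prime p" "x \<ge> 0"
  shows "\<bar>real (card {n \<in> sqfree_upto x. \<forall>p\<in>D. p dvd n})
          - sqfree_density * x * (\<Prod>p\<in>D. 1 / (real p + 1))\<bar> \<le> (3 + sqfree_density) * 3 ^ card D * sqrt x"
  using assms
proof (induction D arbitrary: x rule: finite_induct)
  case empty
  thus ?case
    using card_sqfree_upto_bound[of x] sqfree_density_pos
    by (simp add: distrib_right add_increasing2)
next
  case (insert p D)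
  define C where "C = 3 + sqfree_density"
  define w where "w = (\<Prod>p\<in>D. 1 / (real p + 1))"
  have C: "C > 0" using sqfree_density_pos by (simp add: C_def)
  have w: "0 \<le> w" "w \<le> 1" unfolding w_def by (auto intro!: prod_nonneg prod_le_1)
  have p: "prime p" and D: "\<forall>q\<in>D. prime q" using insert.prems by auto
  have p2: "real p \<ge> 2" using prime_ge_2_nat[OF p] by simp
  let ?R = "\<lambda>x. real (card {n \<in> sqfree_upto x. \<forall>q\<in>insert p D. q dvd n})"
  let ?m = "\<lambda>x. sqfree_density * x * (w / (real p + 1))"
  \<comment> \<open>The inner induction descends in the real variable by way of an integer bound: if
    \<open>1 \<le> x < Suc k\<close>, then \<open>x / p \<le> x / 2 < k\<close>.\<close>
  have "\<bar>?R x - ?m x\<bar> \<le> C * 3 ^ Suc (card D) * sqrt x" if "x \<ge> 0" "x < real k" for x k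
    using that
  proof (induction k arbitrary: x)
    case 0
    thus ?case by simp
  next
    case (Suc k)
    show ?case
    proof (cases "x < 1")
      case True
      \<comment> \<open>Below 1 the count is zero and the main term alone has to be absorbed, which
        is why \<open>C\<close> contains \<open>sqfree_density\<close> besides the 3 of the base
        case.\<close>
      hence "{n \<in> sqfree_upto x. \<forall>q\<in>insert p D. q dvd n} = {}"
        by (auto simp: sqfree_upto_eq)
      hence R0: "?R x = 0" by (simp only: card.empty)
      have "\<bar>?m x\<bar> \<le> sqfree_density * x * 1"
        using sqfree_density_pos Suc.prems w p2
        by (auto simp: abs_mult divide_le_eq intro!: mult_left_mono)
      also have "\<dots> \<le> C * sqrt x"
      proof -
        have "x \<le> sqrt x" using True Suc.prems by (intro real_le_rsqrt) (simp add: power2_eq_square mult_left_le)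
        thus ?thesis using sqfree_density_pos Suc.prems by (auto simp: C_def intro!: mult_mono)
      qed
      also have "\<dots> \<le> C * 3 ^ Suc (card D) * sqrt x"
        using C Suc.prems one_le_power[of "3::real" "Suc (card D)"] by (intro mult_right_mono) auto
      finally show ?thesis unfolding R0 by simp
    next
      case False
      define y where "y = x / real p"
      have y0: "y \<ge> 0" using Suc.prems by (simp add: y_def)
      have "y \<le> x / 2" unfolding y_def using False p2 by (intro divide_left_mono) auto
      hence "y < real k" using Suc.prems False by (cases k) auto
      with y0 have IH1: "\<bar>?R y - ?m y\<bar> \<le> C * 3 ^ Suc (card D) * sqrt y" by (intro Suc.IH)
      have IH2: "\<bar>real (card {n \<in> sqfree_upto y. \<forall>q\<in>D. q dvd n}) - sqfree_density * y * w\<bar>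
            \<le> C * 3 ^ card D * sqrt y"
        unfolding C_def w_def by (rule insert.IH[OF D y0])
      have "?R x + ?R y = real (card {n \<in> sqfree_upto y. \<forall>q\<in>D. q dvd n})"
        unfolding y_def of_nat_add[symmetric]
        by (rule arg_cong[OF card_sqfree_upto_multiples_insert[OF p D insert.hyps(2)]])
      moreover have "?m x + ?m y = sqfree_density * y * w"
      proof -
        have "x * (real p * (real p + 1)) = (x + x * real p) * real p" by (simp add: algebra_simps)
        moreover have "real p + 1 \<noteq> 0" "real p \<noteq> 0" using p2 by auto
        ultimately show ?thesis by (simp add: y_def add_divide_distrib[symmetric] divide_simps) (simp add: algebra_simps)
      qed
      moreover have "\<bar>a - d\<bar> \<le> h + g"
        if "a + b = c" "d + e = f" "\<bar>b - e\<bar> \<le> g" "\<bar>c - f\<bar> \<le> h" for a b c d e f g h :: real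
        using that by linarith
      ultimately have "\<bar>?R x - ?m x\<bar> \<le> C * 3 ^ card D * sqrt y + C * 3 ^ Suc (card D) * sqrt y"
        using IH1 IH2 by blast
      also have "\<dots> = C * 3 ^ card D * (4 * sqrt y)" by simp
      also have "4 * sqrt y \<le> 3 * sqrt x"
      proof -
        have "16 * y \<le> 9 * x" using \<open>y \<le> x / 2\<close> False by simp
        hence "sqrt (16 * y) \<le> sqrt (9 * x)" by (rule real_sqrt_le_mono)
        thus ?thesis by (simp add: real_sqrt_mult)
      qed
      finally show ?thesis using C by (simp add: mult_ac)
    qed
  qed
  moreover obtain k :: nat where "x < real k" using reals_Archimedean2 by blast
  ultimately show ?case using insert by (simp add: C_def w_def)
qed

section \<open>Characteristic functions and moments\<close>

text \<open>\<open>\<delta>\<close> is meant as the difference of two laws on subsets of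
  \<open>P\<close> that nearly agree on the events \<open>D \<subseteq> T\<close>. One factor
  \<open>sum g T - a\<close> is expanded at a time: \<open>D \<subseteq> T\<close> together with
  \<open>p \<in> T\<close> is \<open>insert p D \<subseteq> T\<close>, so each factor enlarges
  \<open>D\<close> by at most one element and costs the total weight of its coefficients. The case
  of interest is \<open>D = {}\<close>; a general \<open>D\<close> makes the induction
  close.\<close>

lemma signed_moment_bound:
  fixes \<delta> :: "'a set \<Rightarrow> real" and g :: "'a \<Rightarrow> real"
  assumes P: "finite P"
    and eps: "\<And>D. D \<subseteq> P \<Longrightarrow> card D \<le> K \<Longrightarrow> \<bar>\<Sum>T\<in>Pow P. \<delta> T * of_bool (D \<subseteq> T)\<bar> \<le> \<epsilon>"
  assumes "D \<subseteq> P" "card D + k \<le> K"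
  shows "\<bar>\<Sum>T\<in>Pow P. \<delta> T * of_bool (D \<subseteq> T) * (sum g T - a) ^ k\<bar> \<le> ((\<Sum>p\<in>P. \<bar>g p\<bar>) + \<bar>a\<bar>) ^ k * \<epsilon>"
  using assms(3,4)
proof (induction k arbitrary: D)
  case 0
  thus ?case using eps[of D] by simp
next
  case (Suc k)
  define F where "F = (\<lambda>D. \<Sum>T\<in>Pow P. \<delta> T * of_bool (D \<subseteq> T) * (sum g T - a) ^ k)"
  define M where "M = (\<Sum>p\<in>P. \<bar>g p\<bar>) + \<bar>a\<bar>"
  have IH: "\<bar>F D'\<bar> \<le> M ^ k * \<epsilon>" if "D' \<subseteq> P" "card D' + k \<le> K" for D'
    unfolding F_def M_def by (rule Suc.IH[OF that])
  have "(\<Sum>T\<in>Pow P. \<delta> T * of_bool (D \<subseteq> T) * (sum g T - a) ^ Suc k)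
      = (\<Sum>T\<in>Pow P. (\<Sum>p\<in>P. g p * (\<delta> T * of_bool (insert p D \<subseteq> T) * (sum g T - a) ^ k))
            - a * (\<delta> T * of_bool (D \<subseteq> T) * (sum g T - a) ^ k))"
  proof (intro sum.cong refl)
    fix T assume T: "T \<in> Pow P"
    have "sum g T = (\<Sum>p\<in>P. g p * of_bool (p \<in> T))"
      using P T by (intro sum.mono_neutral_cong_left) auto
    hence "\<delta> T * of_bool (D \<subseteq> T) * (sum g T - a) ^ Suc k
        = \<delta> T * of_bool (D \<subseteq> T) * (sum g T - a) ^ k * ((\<Sum>p\<in>P. g p * of_bool (p \<in> T)) - a)"
      by simp
    also have "\<dots> = (\<Sum>p\<in>P. g p * (\<delta> T * of_bool (insert p D \<subseteq> T) * (sum g T - a) ^ k))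
            - a * (\<delta> T * of_bool (D \<subseteq> T) * (sum g T - a) ^ k)"
      unfolding right_diff_distrib sum_distrib_left
      by (intro arg_cong2[of _ _ _ _ "(-)"] sum.cong refl) (auto simp: of_bool_def)
    finally show "\<delta> T * of_bool (D \<subseteq> T) * (sum g T - a) ^ Suc k = \<dots>" .
  qed
  also have "\<dots> = (\<Sum>p\<in>P. g p * F (insert p D)) - a * F D"
    unfolding F_def sum_subtractf sum_distrib_left by (subst sum.swap) simp
  also have "\<bar>\<dots>\<bar> \<le> (\<Sum>p\<in>P. \<bar>g p\<bar> * (M ^ k * \<epsilon>)) + \<bar>a\<bar> * (M ^ k * \<epsilon>)"
  proof -
    have "\<bar>F (insert p D)\<bar> \<le> M ^ k * \<epsilon>" if "p \<in> P" for p
      using that Suc.prems card_insert_le_m1[of "Suc (card D)" D p] by (intro IH) auto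
    hence "\<bar>\<Sum>p\<in>P. g p * F (insert p D)\<bar> \<le> (\<Sum>p\<in>P. \<bar>g p\<bar> * (M ^ k * \<epsilon>))"
      by (intro order.trans[OF sum_abs] sum_mono) (auto simp: abs_mult intro!: mult_left_mono)
    moreover have "\<bar>a * F D\<bar> \<le> \<bar>a\<bar> * (M ^ k * \<epsilon>)"
      using IH[of D] Suc.prems by (auto simp: abs_mult intro!: mult_left_mono)
    ultimately show ?thesis by linarith
  qed
  also have "\<dots> = ((\<Sum>p\<in>P. \<bar>g p\<bar>) + \<bar>a\<bar>) * (M ^ k * \<epsilon>)"
    by (simp only: sum_distrib_right distrib_right)
  also have "\<dots> = M ^ Suc k * \<epsilon>"
    by (simp flip: M_def)
  finally show ?case by (simp add: M_def)
qed

lemma power_div_fact_le_exp: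
  fixes x :: real
  assumes "x \<ge> 0"
  shows "x ^ n / fact n \<le> exp x"
proof -
  have "x ^ n / fact n = (\<Sum>k\<in>{n}. x ^ k /\<^sub>R fact k)" by (simp add: divide_inverse mult.commute)
  also have "\<dots> \<le> (\<Sum>k. x ^ k /\<^sub>R fact k)"
    using assms by (intro sum_le_suminf summable_exp_generic) auto
  finally show ?thesis by (simp add: exp_def)
qed

lemma sum_power_div_fact_le_exp:
  fixes x :: real
  assumes "x \<ge> 0"
  shows "(\<Sum>k\<le>n. x ^ k / fact k) \<le> exp x"
proof -
  have "(\<Sum>k\<le>n. x ^ k / fact k) = (\<Sum>k\<le>n. x ^ k /\<^sub>R fact k)" by (simp add: divide_inverse mult.commute)
  also have "\<dots> \<le> (\<Sum>k. x ^ k /\<^sub>R fact k)"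
    using assms by (intro sum_le_suminf summable_exp_generic) auto
  finally show ?thesis by (simp add: exp_def)
qed

text \<open>The Taylor remainders under \<open>v\<close> and \<open>w\<close> are both even moments of order \<open>2 m\<close>; the one under
  \<open>v\<close> is traded for the one under \<open>w\<close>, so exponential moments are needed only for \<open>w\<close>.\<close>

lemma char_diff_le_moment_diff:
  fixes v w Z :: "'b \<Rightarrow> real" and m :: nat
  assumes v: "\<And>T. T \<in> X \<Longrightarrow> v T \<ge> 0" and w: "\<And>T. T \<in> X \<Longrightarrow> w T \<ge> 0"
    and m: "m \<ge> 1"
    and mom: "\<And>j. j \<le> 2 * m \<Longrightarrow> \<bar>\<Sum>T\<in>X. (v T - w T) * Z T ^ j\<bar> \<le> \<eta>"
  shows "cmod ((\<Sum>T\<in>X. v T * iexp (t * Z T)) - (\<Sum>T\<in>X. w T * iexp (t * Z T)))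
          \<le> \<eta> * exp \<bar>t\<bar> + 2 * (1 / 4) ^ m * (\<Sum>T\<in>X. w T * (exp (2 * t * Z T) + exp (- 2 * t * Z T)))"
proof -
  \<comment> \<open>An odd Taylor order makes the remainder exponent \<open>2 * m\<close> even, so
    the absolute moment that bounds it is an ordinary one and \<open>mom\<close> applies to
    it.\<close>
  define n where "n = 2 * m - 1"
  have n: "Suc n = 2 * m" using m by (simp add: n_def)
  define R where "R = (\<lambda>T. iexp (t * Z T) - (\<Sum>k\<le>n. (\<i> * complex_of_real (t * Z T)) ^ k / fact k))"
  define H where "H = t ^ (2 * m) / fact (2 * m)"
  have H0: "H \<ge> 0" by (simp add: H_def)
  have R: "cmod (R T) \<le> H * Z T ^ (2 * m)" for T
    using iexp_approx1[of "t * Z T" n] unfolding R_def n H_def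
    by (simp add: power_mult_distrib power_even_abs abs_mult)
  have Reven: "0 \<le> H * Z T ^ (2 * m)" for T using H0 by simp
  have "(\<Sum>T\<in>X. v T * iexp (t * Z T)) - (\<Sum>T\<in>X. w T * iexp (t * Z T))
      = (\<Sum>T\<in>X. (v T - w T) * (R T + (\<Sum>k\<le>n. (\<i> * complex_of_real (t * Z T)) ^ k / fact k)))"
    by (simp add: R_def sum_subtractf algebra_simps)
  also have "\<dots> = (\<Sum>T\<in>X. (v T - w T) * R T)
      + (\<Sum>T\<in>X. \<Sum>k\<le>n. (\<i> * t) ^ k / fact k * ((v T - w T) * Z T ^ k))"
    by (simp add: sum.distrib distrib_left sum_distrib_left power_mult_distrib mult_ac)
  also have "(\<Sum>T\<in>X. \<Sum>k\<le>n. (\<i> * t) ^ k / fact k * ((v T - w T) * Z T ^ k))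
      = (\<Sum>k\<le>n. (\<i> * t) ^ k / fact k * complex_of_real (\<Sum>T\<in>X. (v T - w T) * Z T ^ k))"
    by (subst sum.swap) (simp add: sum_distrib_left)
  finally have eq: "(\<Sum>T\<in>X. v T * iexp (t * Z T)) - (\<Sum>T\<in>X. w T * iexp (t * Z T))
      = (\<Sum>T\<in>X. (v T - w T) * R T)
       + (\<Sum>k\<le>n. (\<i> * t) ^ k / fact k * complex_of_real (\<Sum>T\<in>X. (v T - w T) * Z T ^ k))" .
  have 1: "cmod (\<Sum>k\<le>n. (\<i> * t) ^ k / fact k * complex_of_real (\<Sum>T\<in>X. (v T - w T) * Z T ^ k))
      \<le> (\<Sum>k\<le>n. \<bar>t\<bar> ^ k / fact k * \<eta>)"
  proof (rule order.trans[OF norm_sum], rule sum_mono)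
    fix k assume "k \<in> {..n}"
    hence "\<bar>\<Sum>T\<in>X. (v T - w T) * Z T ^ k\<bar> \<le> \<eta>" using n by (intro mom) auto
    thus "cmod ((\<i> * t) ^ k / fact k * complex_of_real (\<Sum>T\<in>X. (v T - w T) * Z T ^ k))
        \<le> \<bar>t\<bar> ^ k / fact k * \<eta>"
      by (simp add: norm_mult norm_divide norm_power mult_left_mono divide_right_mono del: of_real_sum)
  qed
  have "cmod (\<Sum>T\<in>X. (v T - w T) * R T) \<le> (\<Sum>T\<in>X. (v T + w T) * (H * Z T ^ (2 * m)))"
  proof (rule order.trans[OF norm_sum], rule sum_mono)
    fix T assume T: "T \<in> X"
    have "cmod ((v T - w T) * R T) = \<bar>v T - w T\<bar> * cmod (R T)"
      by (simp add: norm_mult flip: of_real_diff)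
    also have "\<dots> \<le> (v T + w T) * (H * Z T ^ (2 * m))"
      using v[OF T] w[OF T] by (intro mult_mono R) auto
    finally show "cmod ((v T - w T) * R T) \<le> (v T + w T) * (H * Z T ^ (2 * m))" .
  qed
  also have "\<dots> = H * (\<Sum>T\<in>X. (v T - w T) * Z T ^ (2 * m)) + 2 * (\<Sum>T\<in>X. w T * (H * Z T ^ (2 * m)))"
    by (simp add: sum_distrib_left algebra_simps flip: sum.distrib)
  also have "\<dots> \<le> H * \<eta> + 2 * (\<Sum>T\<in>X. w T * ((1 / 4) ^ m * (exp (2 * t * Z T) + exp (- 2 * t * Z T))))"
  proof (intro add_mono mult_left_mono sum_mono)
    show "(\<Sum>T\<in>X. (v T - w T) * Z T ^ (2 * m)) \<le> \<eta>" using mom[of "2 * m"] by (simp add: abs_le_iff)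
    fix T assume "T \<in> X"
    \<comment> \<open>The term of order \<open>2 * m\<close> at \<open>2 * t * Z T\<close> is
      \<open>4 ^ m\<close> times the one at \<open>t * Z T\<close>; doubling the argument is what
      gains the geometric factor.\<close>
    have "H * Z T ^ (2 * m) = (1 / 4) ^ m * (\<bar>2 * t * Z T\<bar> ^ (2 * m) / fact (2 * m))"
      by (simp add: H_def power_even_abs power_mult_distrib power_mult[of 2] power_one_over)
    also have "\<bar>2 * t * Z T\<bar> ^ (2 * m) / fact (2 * m) \<le> exp \<bar>2 * t * Z T\<bar>"
      by (rule power_div_fact_le_exp) simp
    also have "\<dots> \<le> exp (2 * t * Z T) + exp (- 2 * t * Z T)"
      by (auto simp: abs_if)
    finally show "H * Z T ^ (2 * m) \<le> (1 / 4) ^ m * (exp (2 * t * Z T) + exp (- 2 * t * Z T))"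
      by simp
  qed (use w H0 in auto)
  finally have 2: "cmod (\<Sum>T\<in>X. (v T - w T) * R T) \<le> H * \<eta>
      + 2 * (1 / 4) ^ m * (\<Sum>T\<in>X. w T * (exp (2 * t * Z T) + exp (- 2 * t * Z T)))"
    by (simp add: sum_distrib_left mult_ac)
  \<comment> \<open>\<open>H\<close> is the next term of the exponential series of
    \<open>\<bar>t\<bar>\<close>, so all uses of \<open>\<eta>\<close> together cost at most
    \<open>exp \<bar>t\<bar>\<close>.\<close>
  have "(\<Sum>k\<le>Suc n. \<bar>t\<bar> ^ k / fact k) = (\<Sum>k\<le>n. \<bar>t\<bar> ^ k / fact k) + H"
    unfolding sum.atMost_Suc unfolding n H_def by (simp add: power_even_abs)
  hence "(\<Sum>k\<le>n. \<bar>t\<bar> ^ k / fact k * \<eta>) + H * \<eta> = (\<Sum>k\<le>Suc n. \<bar>t\<bar> ^ k / fact k) * \<eta>"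
    by (simp only: distrib_right sum_distrib_right)
  also have "\<dots> \<le> exp \<bar>t\<bar> * \<eta>"
    using mom[of 0] by (intro mult_right_mono sum_power_div_fact_le_exp) auto
  finally show ?thesis unfolding eq using 1 2 norm_triangle_ineq by (smt (verit) mult.commute)
qed

section \<open>Sums over independent events\<close>

text \<open>The probability that exactly \<open>T\<close> is drawn when each \<open>p\<close> in
  \<open>P\<close> is drawn independently with probability \<open>q p\<close>.\<close>

definition bernoulli_weight :: "('a \<Rightarrow> real) \<Rightarrow> 'a set \<Rightarrow> 'a set \<Rightarrow> real" where
  "bernoulli_weight q P T = (\<Prod>p\<in>T. q p) * (\<Prod>p\<in>P - T. 1 - q p)"

lemma bernoulli_weight_nonneg:
  assumes "\<And>p. p \<in> P \<Longrightarrow> 0 \<le> q p \<and> q p \<le> 1" "T \<in> Pow P"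
  shows "bernoulli_weight q P T \<ge> 0"
  using assms unfolding bernoulli_weight_def by (intro mult_nonneg_nonneg prod_nonneg) auto

text \<open>The expectation of a product of independent factors, \<open>a p\<close> if
  \<open>p\<close> is drawn and \<open>b p\<close> otherwise. Inclusion probabilities, exponential
  moments and characteristic functions are all instances, hence a type that covers real and complex
  numbers.\<close>

lemma sum_bernoulli_weight_prod:
  fixes a b :: "'a \<Rightarrow> 'c :: {real_algebra_1, comm_ring_1}"
  assumes "finite P"
  shows "(\<Sum>T\<in>Pow P. of_real (bernoulli_weight q P T) * ((\<Prod>p\<in>T. a p) * (\<Prod>p\<in>P - T. b p)))
       = (\<Prod>p\<in>P. of_real (q p) * a p + of_real (1 - q p) * b p)"
  unfolding prod_add[OF assms] bernoulli_weight_def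
  by (intro sum.cong refl) (simp add: prod.distrib mult_ac)

lemma sum_bernoulli_weight_supset:
  assumes "finite P" "D \<subseteq> P"
  shows "(\<Sum>T\<in>Pow P. bernoulli_weight q P T * of_bool (D \<subseteq> T)) = (\<Prod>p\<in>D. q p)"
proof -
  \<comment> \<open>With \<open>a p = 1\<close> and \<open>b p = of_bool (p \<notin> D)\<close>, the
    product vanishes as soon as some element of \<open>D\<close> is not drawn.\<close>
  have "(\<Sum>T\<in>Pow P. bernoulli_weight q P T * of_bool (D \<subseteq> T))
      = (\<Sum>T\<in>Pow P. of_real (bernoulli_weight q P T) * ((\<Prod>p\<in>T. 1) * (\<Prod>p\<in>P - T. of_bool (p \<notin> D))))"
  proof (intro sum.cong refl)
    fix T assume "T \<in> Pow P"
    have "(\<Prod>p\<in>P - T. of_bool (p \<notin> D) :: real) = of_bool (D \<subseteq> T)"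
    proof (cases "D \<subseteq> T")
      case True
      thus ?thesis by (auto intro!: prod.neutral)
    next
      case False
      with assms show ?thesis by (auto intro!: prod_zero)
    qed
    thus "bernoulli_weight q P T * of_bool (D \<subseteq> T)
        = of_real (bernoulli_weight q P T) * ((\<Prod>p\<in>T. 1) * (\<Prod>p\<in>P - T. of_bool (p \<notin> D)))" by simp
  qed
  also have "\<dots> = (\<Prod>p\<in>P. q p * 1 + (1 - q p) * of_bool (p \<notin> D))"
    by (subst sum_bernoulli_weight_prod[OF assms(1)]) simp
  also have "\<dots> = (\<Prod>p\<in>D. q p)"
    using assms by (intro prod.mono_neutral_cong_right) auto
  finally show ?thesis .
qed

text \<open>Centring is distributed over the draws: \<open>p\<close> contributes
  \<open>c p * (1 - q p)\<close> if drawn and \<open>- c p * q p\<close> if not. A real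
  \<open>s\<close> gives exponential moments, \<open>s = \<i> * t\<close> the characteristic
  function.\<close>

lemma sum_bernoulli_weight_exp:
  fixes s :: "'c :: {real_normed_field, banach}"
  assumes P: "finite P"
  shows "(\<Sum>T\<in>Pow P. of_real (bernoulli_weight q P T) * exp (s * of_real (sum c T - (\<Sum>p\<in>P. c p * q p))))
       = (\<Prod>p\<in>P. of_real (q p) * exp (s * of_real (c p * (1 - q p))) + of_real (1 - q p) * exp (s * of_real (- c p * q p)))"
proof -
  have "(\<Sum>T\<in>Pow P. of_real (bernoulli_weight q P T) * exp (s * of_real (sum c T - (\<Sum>p\<in>P. c p * q p))))
      = (\<Sum>T\<in>Pow P. of_real (bernoulli_weight q P T) *
          ((\<Prod>p\<in>T. exp (s * of_real (c p * (1 - q p)))) * (\<Prod>p\<in>P - T. exp (s * of_real (- c p * q p)))))"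
  proof (intro sum.cong refl arg_cong2[of _ _ _ _ "(*)"])
    fix T assume T: "T \<in> Pow P"
    hence fT: "finite T" using P finite_subset by auto
    have "sum c T - (\<Sum>p\<in>P. c p * q p) = (\<Sum>p\<in>T. c p * (1 - q p)) + (\<Sum>p\<in>P - T. - c p * q p)"
      using sum.subset_diff[of T P "\<lambda>p. c p * q p"] T P
      by (simp add: sum_subtractf sum_negf algebra_simps)
    thus "exp (s * of_real (sum c T - (\<Sum>p\<in>P. c p * q p)))
        = (\<Prod>p\<in>T. exp (s * of_real (c p * (1 - q p)))) * (\<Prod>p\<in>P - T. exp (s * of_real (- c p * q p)))"
      using fT P by (simp only: of_real_add of_real_sum distrib_left sum_distrib_left exp_add exp_sum finite_Diff)
  qed
  also have "\<dots> = (\<Prod>p\<in>P. of_real (q p) * exp (s * of_real (c p * (1 - q p))) + of_real (1 - q p) * exp (s * of_real (- c p * q p)))"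
    by (rule sum_bernoulli_weight_prod[OF P])
  finally show ?thesis .
qed

text \<open>Multiplying \<open>1 - x + x\<^sup>2\<close> by the quadratic Taylor lower bound for
  \<open>exp x\<close> gives a polynomial with constant term 1 and no negative coefficients.\<close>

lemma exp_minus_le_quadratic:
  fixes x :: real
  assumes "x \<ge> 0"
  shows "exp (- x) \<le> 1 - x + x\<^sup>2"
proof -
  have "1 \<le> 1 + x\<^sup>2 / 2 + x ^ 3 / 2 + x ^ 4 / 2" using assms by simp
  also have "\<dots> = (1 - x + x\<^sup>2) * (1 + x + x\<^sup>2 / 2)"
    by (simp add: field_simps power2_eq_square power3_eq_cube power4_eq_xxxx)
  also have "\<dots> \<le> (1 - x + x\<^sup>2) * exp x"
  proof (intro mult_left_mono exp_lower_Taylor_quadratic assms)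
    have "1 - x + x\<^sup>2 = (x - 1 / 2)\<^sup>2 + 3 / 4" by (simp add: power2_eq_square algebra_simps)
    thus "0 \<le> 1 - x + x\<^sup>2" by (metis add_nonneg_nonneg zero_le_power2 divide_nonneg_nonneg zero_le_numeral)
  qed
  finally show ?thesis by (simp add: exp_minus field_simps)
qed

lemma exp_le_quadratic:
  fixes x :: real
  assumes "x \<le> 1"
  shows "exp x \<le> 1 + x + x\<^sup>2"
  using exp_bound[of x] exp_minus_le_quadratic[of "- x"] assms by (cases "x \<ge> 0") auto

text \<open>The condition \<open>\<bar>s * c p\<bar> \<le> 1\<close> permits the quadratic bound for
  \<open>exp\<close> on both outcomes of a draw, and centring cancels the linear terms. Each factor
  is then at most \<open>exp ((s * c p)\<^sup>2 * q p)\<close>, and the product sees only the sum in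
  \<open>var\<close>.\<close>

lemma bernoulli_exp_moment_le:
  assumes P: "finite P" and q: "\<And>p. p \<in> P \<Longrightarrow> 0 \<le> q p \<and> q p \<le> 1"
    and s: "\<And>p. p \<in> P \<Longrightarrow> \<bar>s * c p\<bar> \<le> 1"
    and var: "(\<Sum>p\<in>P. (c p)\<^sup>2 * q p) \<le> 1"
  shows "(\<Sum>T\<in>Pow P. bernoulli_weight q P T * exp (s * (sum c T - (\<Sum>p\<in>P. c p * q p)))) \<le> exp (s\<^sup>2)"
proof -
  have "(\<Sum>T\<in>Pow P. bernoulli_weight q P T * exp (s * (sum c T - (\<Sum>p\<in>P. c p * q p))))
      = (\<Prod>p\<in>P. q p * exp (s * (c p * (1 - q p))) + (1 - q p) * exp (s * (- c p * q p)))"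
    using sum_bernoulli_weight_exp[OF P, of q s c] by simp
  also have "\<dots> \<le> (\<Prod>p\<in>P. exp ((s * c p)\<^sup>2 * q p))"
  proof (intro prod_mono conjI)
    fix p assume p: "p \<in> P"
    define v where "v = s * c p"
    have q01: "0 \<le> q p" "q p \<le> 1" using q[OF p] by auto
    have v: "\<bar>v\<bar> \<le> 1" using s[OF p] by (simp add: v_def)
    show "0 \<le> q p * exp (s * (c p * (1 - q p))) + (1 - q p) * exp (s * (- c p * q p))"
      using q01 by simp
    have le1: "y \<le> 1" if "\<bar>y\<bar> \<le> \<bar>v\<bar> * 1" for y using that v by linarith
    have "v * (1 - q p) \<le> 1"
      by (rule le1, unfold abs_mult, rule mult_left_mono) (use q01 in auto)
    moreover have "v * (- q p) \<le> 1"
      by (rule le1, unfold abs_mult, rule mult_left_mono) (use q01 in auto)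
    ultimately have "q p * exp (v * (1 - q p)) + (1 - q p) * exp (v * (- q p))
        \<le> q p * (1 + v * (1 - q p) + (v * (1 - q p))\<^sup>2) + (1 - q p) * (1 + v * (- q p) + (v * (- q p))\<^sup>2)"
      using q01 by (intro add_mono mult_left_mono exp_le_quadratic) auto
    also have "\<dots> = 1 + v\<^sup>2 * (q p * (1 - q p))"
      by (simp add: algebra_simps power2_eq_square power3_eq_cube)
    also have "\<dots> \<le> 1 + v\<^sup>2 * q p"
      using q01 by (intro add_left_mono mult_left_mono) (auto simp: mult_left_le)
    also have "\<dots> \<le> exp (v\<^sup>2 * q p)" by (rule exp_ge_add_one_self)
    finally show "q p * exp (s * (c p * (1 - q p))) + (1 - q p) * exp (s * (- c p * q p)) \<le> exp ((s * c p)\<^sup>2 * q p)"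
      by (simp add: v_def mult_ac)
  qed
  also have "\<dots> = exp (s\<^sup>2 * (\<Sum>p\<in>P. (c p)\<^sup>2 * q p))"
    using P by (simp add: exp_sum sum_distrib_left power_mult_distrib mult_ac)
  also have "\<dots> \<le> exp (s\<^sup>2)" using var by (simp add: mult_left_le)
  finally show ?thesis .
qed

text \<open>Both the factor and its Gaussian counterpart are compared with \<open>1 - v\<close>,
  where \<open>v\<close> is \<open>t\<^sup>2 / 2\<close> times the variance of one draw. The Taylor
  remainder gives a cubic error, and \<open>exp (- v)\<close> one of size \<open>v\<^sup>2\<close>.
  In each a factor \<open>c\<^sup>2 * q\<close> is kept for the summation over \<open>p\<close>, and
  the rest is bounded through \<open>\<beta>\<close>.\<close>

lemma bernoulli_char_factor_bound:
  fixes c q t :: real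
  assumes q: "0 \<le> q" "q \<le> 1" and c: "\<bar>c\<bar> \<le> \<beta>"
  shows "cmod ((of_real q * iexp (t * (c * (1 - q))) + of_real (1 - q) * iexp (t * (- c * q)))
       - of_real (exp (- (t\<^sup>2 * (c\<^sup>2 * (q * (1 - q))) / 2)))) \<le> (\<bar>t\<bar> ^ 3 * \<beta> + t ^ 4 * \<beta>\<^sup>2) * (c\<^sup>2 * q)"
proof -
  define v where "v = t\<^sup>2 * (c\<^sup>2 * (q * (1 - q))) / 2"
  have v0: "v \<ge> 0" using q by (simp add: v_def)
  define E where "E = (\<lambda>y. iexp y - (1 + \<i> * y - of_real (y\<^sup>2 / 2)))"
  have E: "cmod (E y) \<le> \<bar>y\<bar> ^ 3 / 6" for y :: real
    using iexp_approx1[of y 2] by (simp add: E_def eval_nat_numeral algebra_simps power2_eq_square fact_numeral)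
  have "of_real q * iexp (t * (c * (1 - q))) + of_real (1 - q) * iexp (t * (- c * q)) - of_real (1 - v)
      = of_real q * E (t * (c * (1 - q))) + of_real (1 - q) * E (t * (- c * q))"
    unfolding E_def v_def by (simp add: algebra_simps power2_eq_square add_divide_distrib diff_divide_distrib)
  also have "cmod \<dots> \<le> q * (\<bar>t * c\<bar> ^ 3 / 6) + 1 * (\<bar>t * c\<bar> ^ 3 * q / 6)"
  proof (rule order.trans[OF norm_triangle_ineq], rule add_mono)
    have "cmod (of_real q * E (t * (c * (1 - q)))) \<le> q * (\<bar>t * (c * (1 - q))\<bar> ^ 3 / 6)"
      using q mult_left_mono[OF E, of q] by (simp only: norm_mult norm_of_real abs_of_nonneg)
    also have "\<bar>t * (c * (1 - q))\<bar> ^ 3 \<le> \<bar>t * c\<bar> ^ 3"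
      using q by (intro power_mono) (auto simp: abs_mult mult_left_le mult_ac intro!: mult_left_mono)
    finally show "cmod (of_real q * E (t * (c * (1 - q)))) \<le> q * (\<bar>t * c\<bar> ^ 3 / 6)"
      using q by (simp add: mult_left_mono divide_right_mono)
    \<comment> \<open>The weight \<open>1 - q\<close> need not be small, but the deviation is only
      \<open>c * q\<close>; its cube supplies the factor \<open>q\<close>.\<close>
    have "cmod (of_real (1 - q) * E (t * (- c * q))) \<le> 1 * (\<bar>t * (- c * q)\<bar> ^ 3 / 6)"
      using q unfolding norm_mult norm_of_real by (intro mult_mono E) auto
    also have "\<bar>t * (- c * q)\<bar> ^ 3 = \<bar>t * c\<bar> ^ 3 * q ^ 3"
      using q by (simp add: abs_mult power_mult_distrib)
    also have "\<dots> \<le> \<bar>t * c\<bar> ^ 3 * q"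
      using q power_decreasing[of 1 3 q] by (intro mult_left_mono) auto
    finally show "cmod (of_real (1 - q) * E (t * (- c * q))) \<le> 1 * (\<bar>t * c\<bar> ^ 3 * q / 6)"
      by simp
  qed
  also have "\<dots> \<le> \<bar>t * c\<bar> ^ 3 * q" using q by simp
  also have "\<dots> = \<bar>t\<bar> ^ 3 * \<bar>c\<bar> * (c\<^sup>2 * q)"
    by (simp add: abs_mult power_mult_distrib power3_eq_cube power2_eq_square mult_ac)
  also have "\<dots> \<le> \<bar>t\<bar> ^ 3 * \<beta> * (c\<^sup>2 * q)"
    using c q by (intro mult_right_mono mult_left_mono) auto
  finally have 1: "cmod (of_real q * iexp (t * (c * (1 - q))) + of_real (1 - q) * iexp (t * (- c * q)) - of_real (1 - v))
      \<le> \<bar>t\<bar> ^ 3 * \<beta> * (c\<^sup>2 * q)" .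
  have "\<bar>(1 - v) - exp (- v)\<bar> \<le> v\<^sup>2"
    using exp_minus_le_quadratic[OF v0] exp_ge_add_one_self[of "- v"] by linarith
  also have "v\<^sup>2 = t ^ 4 * (c ^ 2) * (c\<^sup>2 * (q * (q * (1 - q)\<^sup>2))) / 4"
    by (simp add: v_def power2_eq_square power4_eq_xxxx)
  also have "\<dots> \<le> t ^ 4 * \<beta>\<^sup>2 * (c\<^sup>2 * (q * 1)) / 1"
  proof (intro frac_le mult_mono mult_left_mono)
    show "c\<^sup>2 \<le> \<beta>\<^sup>2" using c by (metis abs_ge_zero power2_abs power_mono)
    have "q * (1 - q)\<^sup>2 \<le> 1 * 1\<^sup>2" using q by (intro mult_mono power_mono) auto
    thus "q * (1 - q)\<^sup>2 \<le> 1" by simp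
  qed (use q in auto)
  finally have "\<bar>(1 - v) - exp (- v)\<bar> \<le> t ^ 4 * \<beta>\<^sup>2 * (c\<^sup>2 * q)" by simp
  hence 2: "cmod (of_real (1 - v) - of_real (exp (- v))) \<le> t ^ 4 * \<beta>\<^sup>2 * (c\<^sup>2 * q)"
    by (metis norm_of_real of_real_diff)
  show ?thesis unfolding v_def[symmetric] distrib_right
    by (rule norm_diff_triangle_le[OF 1 2])
qed

text \<open>Products of numbers of modulus at most 1 differ by at most the sum of the differences of
  their factors. Since \<open>(c p)\<^sup>2 * q p\<close> sums to at most 1, the error depends on
  \<open>t\<close> and the coefficient bound \<open>\<beta>\<close> but not on the size of
  \<open>P\<close>.\<close>

lemma bernoulli_char_bound:
  assumes P: "finite P" and q: "\<And>p. p \<in> P \<Longrightarrow> 0 \<le> q p \<and> q p \<le> 1"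
    and c: "\<And>p. p \<in> P \<Longrightarrow> \<bar>c p\<bar> \<le> \<beta>" and \<beta>: "\<beta> \<ge> 0"
    and var: "(\<Sum>p\<in>P. (c p)\<^sup>2 * q p) \<le> 1"
  shows "cmod ((\<Sum>T\<in>Pow P. bernoulli_weight q P T * iexp (t * (sum c T - (\<Sum>p\<in>P. c p * q p))))
          - of_real (exp (- (t\<^sup>2 * (\<Sum>p\<in>P. (c p)\<^sup>2 * (q p * (1 - q p))) / 2)))) \<le> \<bar>t\<bar> ^ 3 * \<beta> + t ^ 4 * \<beta>\<^sup>2"
proof -
  define f where "f = (\<lambda>p. of_real (q p) * iexp (t * (c p * (1 - q p))) + of_real (1 - q p) * iexp (t * (- c p * q p)))"
  define e where "e = (\<lambda>p. complex_of_real (exp (- (t\<^sup>2 * ((c p)\<^sup>2 * (q p * (1 - q p))) / 2))))"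
  have "(\<Sum>T\<in>Pow P. bernoulli_weight q P T * iexp (t * (sum c T - (\<Sum>p\<in>P. c p * q p)))) = prod f P"
    using sum_bernoulli_weight_exp[OF P, of q "\<i> * of_real t :: complex" c]
    by (simp add: f_def mult_ac)
  moreover have "complex_of_real (exp (- (t\<^sup>2 * (\<Sum>p\<in>P. (c p)\<^sup>2 * (q p * (1 - q p))) / 2))) = prod e P"
    unfolding e_def of_real_prod[symmetric] exp_sum[OF P, symmetric]
    by (simp add: sum_negf sum_distrib_left sum_divide_distrib)
  moreover have "cmod (prod f P - prod e P) \<le> (\<Sum>p\<in>P. cmod (f p - e p))"
  proof (rule norm_prod_diff)
    fix p assume p: "p \<in> P"
    have "cmod (f p) \<le> q p * 1 + (1 - q p) * 1"
      unfolding f_def using q[OF p]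
      by (intro order.trans[OF norm_triangle_ineq] add_mono) (auto simp: norm_mult simp del: of_real_diff)
    thus "cmod (f p) \<le> 1" by simp
    show "cmod (e p) \<le> 1" using q[OF p] by (simp add: e_def)
  qed
  moreover have "(\<Sum>p\<in>P. cmod (f p - e p)) \<le> (\<Sum>p\<in>P. (\<bar>t\<bar> ^ 3 * \<beta> + t ^ 4 * \<beta>\<^sup>2) * ((c p)\<^sup>2 * q p))"
    unfolding f_def e_def using q c by (intro sum_mono bernoulli_char_factor_bound) auto
  moreover have "\<dots> \<le> \<bar>t\<bar> ^ 3 * \<beta> + t ^ 4 * \<beta>\<^sup>2"
    using var \<beta> unfolding sum_distrib_left[symmetric] by (intro mult_left_le) auto
  ultimately show ?thesis by simp
qed

section \<open>Comparison of an empirical law with the independent model\<close>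

lemma sum_fibre_frequency:
  fixes F :: "'a set \<Rightarrow> 'c :: real_field"
  assumes "finite P" "finite S" "\<And>n. n \<in> S \<Longrightarrow> \<tau> n \<subseteq> P"
  shows "(\<Sum>T\<in>Pow P. of_real (real (card {n \<in> S. \<tau> n = T}) / real (card S)) * F T)
       = (\<Sum>n\<in>S. F (\<tau> n)) / of_nat (card S)"
proof -
  have "(\<Sum>n\<in>S. F (\<tau> n)) = (\<Sum>T\<in>Pow P. \<Sum>n | n \<in> S \<and> \<tau> n = T. F (\<tau> n))"
    using assms by (intro sum.group[symmetric]) auto
  also have "\<dots> = (\<Sum>T\<in>Pow P. of_nat (card {n \<in> S. \<tau> n = T}) * F T)"
    by (intro sum.cong refl) simp
  finally show ?thesis
    by (simp add: sum_divide_distrib of_real_divide)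
qed

text \<open>In the application \<open>S\<close> consists of the squarefree numbers up to
  \<open>x\<close>, and \<open>\<tau> n\<close> of the small primes dividing \<open>n\<close>. The
  law of \<open>\<tau>\<close> is compared with the independent draw through moments, and the draw
  with a Gaussian. The first error term comes from the moment differences, the second from the
  Taylor tail, the last two from the Gaussian comparison.\<close>

lemma empirical_char_bound:
  fixes S :: "'b set" and \<tau> :: "'b \<Rightarrow> 'a set" and q c :: "'a \<Rightarrow> real"
  assumes P: "finite P" and S: "finite S" "S \<noteq> {}" and \<tau>: "\<And>n. n \<in> S \<Longrightarrow> \<tau> n \<subseteq> P"
    and q: "\<And>p. p \<in> P \<Longrightarrow> 0 \<le> q p \<and> q p \<le> 1"
    and c: "\<And>p. p \<in> P \<Longrightarrow> \<bar>c p\<bar> \<le> \<beta>" and \<beta>: "\<beta> \<ge> 0" "2 * \<bar>t\<bar> * \<beta> \<le> 1"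
    and var: "(\<Sum>p\<in>P. (c p)\<^sup>2 * q p) \<le> 1"
    and Y: "(\<Sum>p\<in>P. \<bar>c p\<bar>) \<le> Y" "1 \<le> Y" and m: "m \<ge> 1"
    and eps: "\<And>D. D \<subseteq> P \<Longrightarrow> card D \<le> 2 * m \<Longrightarrow>
        \<bar>real (card {n \<in> S. D \<subseteq> \<tau> n}) / real (card S) - (\<Prod>p\<in>D. q p)\<bar> \<le> \<epsilon>"
  shows "cmod ((\<Sum>n\<in>S. iexp (t * (sum c (\<tau> n) - (\<Sum>p\<in>P. c p * q p)))) / of_nat (card S)
        - of_real (exp (- (t\<^sup>2 * (\<Sum>p\<in>P. (c p)\<^sup>2 * (q p * (1 - q p))) / 2))))
      \<le> (2 * Y) ^ (2 * m) * \<epsilon> * exp \<bar>t\<bar> + 4 * (1 / 4) ^ m * exp (4 * t\<^sup>2) + \<bar>t\<bar> ^ 3 * \<beta> + t ^ 4 * \<beta>\<^sup>2"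
proof -
  define v where "v = (\<lambda>T. real (card {n \<in> S. \<tau> n = T}) / real (card S))"
  define w where "w = bernoulli_weight q P"
  define a where "a = (\<Sum>p\<in>P. c p * q p)"
  define Z where "Z = (\<lambda>T. sum c T - a)"
  have \<epsilon>: "\<epsilon> \<ge> 0" using order.trans[OF abs_ge_zero eps[of "{}"]] by simp
  have vF: "(\<Sum>T\<in>Pow P. of_real (v T) * F T) = (\<Sum>n\<in>S. F (\<tau> n)) / of_nat (card S)"
    for F :: "'a set \<Rightarrow> 'c :: real_field"
    unfolding v_def by (rule sum_fibre_frequency[OF P S(1) \<tau>])
  have mom: "\<bar>\<Sum>T\<in>Pow P. (v T - w T) * Z T ^ j\<bar> \<le> (2 * Y) ^ (2 * m) * \<epsilon>" if j: "j \<le> 2 * m" for j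
  proof -
    have "\<bar>\<Sum>T\<in>Pow P. (v T - w T) * of_bool (D \<subseteq> T)\<bar> \<le> \<epsilon>" if D: "D \<subseteq> P" "card D \<le> 2 * m" for D
    proof -
      have "(\<Sum>T\<in>Pow P. v T * of_bool (D \<subseteq> T)) = (\<Sum>n\<in>S. of_bool (D \<subseteq> \<tau> n)) / card S"
        using vF[of "\<lambda>T. of_bool (D \<subseteq> T) :: real"] by simp
      also have "(\<Sum>n\<in>S. of_bool (D \<subseteq> \<tau> n) :: real) = real (card {n \<in> S. D \<subseteq> \<tau> n})"
        using S by (simp add: Int_def)
      finally show ?thesis
        using eps[OF D] sum_bernoulli_weight_supset[OF P D(1), of q]
        by (simp add: left_diff_distrib sum_subtractf w_def)
    qed
    from signed_moment_bound[OF P this, where D = "{}" and k = j and g = c and a = a] j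
    have "\<bar>\<Sum>T\<in>Pow P. (v T - w T) * Z T ^ j\<bar> \<le> ((\<Sum>p\<in>P. \<bar>c p\<bar>) + \<bar>a\<bar>) ^ j * \<epsilon>"
      by (simp add: Z_def)
    also have "\<dots> \<le> (2 * Y) ^ (2 * m) * \<epsilon>"
    proof (intro mult_right_mono \<epsilon>)
      have "\<bar>a\<bar> \<le> (\<Sum>p\<in>P. \<bar>c p\<bar> * 1)"
        unfolding a_def using q by (intro order.trans[OF sum_abs] sum_mono) (auto simp: abs_mult intro!: mult_left_le)
      hence "(\<Sum>p\<in>P. \<bar>c p\<bar>) + \<bar>a\<bar> \<le> 2 * Y" using Y by simp
      hence "((\<Sum>p\<in>P. \<bar>c p\<bar>) + \<bar>a\<bar>) ^ j \<le> (2 * Y) ^ j"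
        by (intro power_mono) (auto intro!: add_nonneg_nonneg sum_nonneg)
      \<comment> \<open>\<open>1 \<le> Y\<close> lets the single exponent \<open>2 * m\<close> serve
        all orders \<open>j\<close>.\<close>
      also have "\<dots> \<le> (2 * Y) ^ (2 * m)" using j Y by (intro power_increasing) auto
      finally show "((\<Sum>p\<in>P. \<bar>c p\<bar>) + \<bar>a\<bar>) ^ j \<le> (2 * Y) ^ (2 * m)" .
    qed
    finally show ?thesis .
  qed
  have w0: "w T \<ge> 0" if "T \<in> Pow P" for T
    unfolding w_def using that q by (intro bernoulli_weight_nonneg) auto
  \<comment> \<open>The Taylor tail involves exponential moments at \<open>2 * t\<close> and
    \<open>- 2 * t\<close>; hence the condition \<open>2 * \<bar>t\<bar> * \<beta> \<le> 1\<close>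
    and the constant \<open>exp (4 * t\<^sup>2)\<close>.\<close>
  have expm: "(\<Sum>T\<in>Pow P. w T * exp (s * Z T)) \<le> exp (4 * t\<^sup>2)" if s: "\<bar>s\<bar> = 2 * \<bar>t\<bar>" for s
  proof -
    have "\<bar>s * c p\<bar> \<le> 1" if "p \<in> P" for p
    proof -
      have "\<bar>s * c p\<bar> \<le> 2 * \<bar>t\<bar> * \<beta>" unfolding abs_mult s using c[OF that] by (intro mult_left_mono) auto
      thus ?thesis using \<beta> by linarith
    qed
    hence "(\<Sum>T\<in>Pow P. w T * exp (s * Z T)) \<le> exp (s\<^sup>2)"
      unfolding w_def Z_def a_def using q var by (intro bernoulli_exp_moment_le P) auto
    also have "s\<^sup>2 = 4 * t\<^sup>2" using arg_cong[OF s, of "\<lambda>y. y\<^sup>2"] by (simp add: power_mult_distrib)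
    finally show ?thesis .
  qed
  have "cmod ((\<Sum>T\<in>Pow P. v T * iexp (t * Z T)) - (\<Sum>T\<in>Pow P. w T * iexp (t * Z T)))
      \<le> (2 * Y) ^ (2 * m) * \<epsilon> * exp \<bar>t\<bar>
        + 2 * (1 / 4) ^ m * (\<Sum>T\<in>Pow P. w T * (exp (2 * t * Z T) + exp (- 2 * t * Z T)))"
    by (rule char_diff_le_moment_diff[OF _ w0 m mom]) (auto simp: v_def)
  also have "(\<Sum>T\<in>Pow P. w T * (exp (2 * t * Z T) + exp (- 2 * t * Z T))) \<le> 2 * exp (4 * t\<^sup>2)"
    using expm[of "2 * t"] expm[of "- 2 * t"] by (simp add: abs_mult distrib_left sum.distrib)
  finally have 1: "cmod ((\<Sum>T\<in>Pow P. v T * iexp (t * Z T)) - (\<Sum>T\<in>Pow P. w T * iexp (t * Z T)))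
      \<le> (2 * Y) ^ (2 * m) * \<epsilon> * exp \<bar>t\<bar> + 4 * (1 / 4) ^ m * exp (4 * t\<^sup>2)"
    by (simp add: mult_left_mono)
  have 2: "cmod ((\<Sum>T\<in>Pow P. w T * iexp (t * Z T))
      - of_real (exp (- (t\<^sup>2 * (\<Sum>p\<in>P. (c p)\<^sup>2 * (q p * (1 - q p))) / 2)))) \<le> \<bar>t\<bar> ^ 3 * \<beta> + t ^ 4 * \<beta>\<^sup>2"
    unfolding w_def Z_def a_def by (rule bernoulli_char_bound[OF P q c \<beta>(1) var])
  have "(\<Sum>T\<in>Pow P. v T * iexp (t * Z T)) = (\<Sum>n\<in>S. iexp (t * Z (\<tau> n))) / of_nat (card S)"
    by (rule vF)
  with norm_diff_triangle_le[OF 1 2] show ?thesis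
    by (simp add: Z_def a_def add_ac)
qed

section \<open>Additive functions and large primes\<close>

lemma additive_on_sqfree_eq_sum:
  assumes g: "additive_on_sqfree g" and n: "squarefree n"
  shows "g n = (\<Sum>p\<in>prime_factors n. g p)"
proof -
  have "g (\<Prod>T) = sum g T" if "finite T" "\<And>p. p \<in> T \<Longrightarrow> prime p" for T
    using that
  proof (induction T rule: finite_induct)
    case empty
    have "g (1 * 1) = g 1 + g 1"
      using g unfolding additive_on_sqfree_def sqfree_nats_def by (metis coprime_1_left mem_Collect_eq squarefree_1)
    thus ?case by simp
  next
    case (insert p T)
    have "coprime p (\<Prod>T)"
      using insert by (intro prod_coprime_right) (metis insertCI primes_coprime)
    moreover have "squarefree p" "squarefree (\<Prod>T)"
      using insert by (auto intro: squarefree_prime squarefree_prod_primes)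
    ultimately have "g (p * \<Prod>T) = g p + g (\<Prod>T)"
      using g unfolding additive_on_sqfree_def sqfree_nats_def by blast
    thus ?case using insert by simp
  qed
  from this[of "prime_factors n"] show ?thesis
    by (simp add: squarefree_eq_prod_prime_factors[OF n] in_prime_factors_iff)
qed

text \<open>Distinct primes dividing \<open>n\<close> have a product of at most \<open>n\<close>, so
  \<open>y ^ card Q \<le> x\<close>.\<close>

lemma card_large_prime_divisors_le:
  fixes x y :: real
  assumes y: "y > 1" and n: "n > 0" "real n \<le> x"
    and Q: "\<And>p. p \<in> Q \<Longrightarrow> prime p \<and> y < real p \<and> p dvd n"
  shows "real (card Q) \<le> ln x / ln y"
proof -
  have sub: "Q \<subseteq> prime_factors n" using Q n by (auto simp: in_prime_factors_iff)
  have "y ^ card Q = (\<Prod>p\<in>Q. y)" by simp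
  also have "\<dots> \<le> (\<Prod>p\<in>Q. real p)" using Q y by (intro prod_mono) force
  also have "\<dots> = real (\<Prod>Q)" by simp
  also have "\<dots> \<le> real n"
    using prod_subset_prime_factors_dvd[OF n(1) sub] n by (intro of_nat_mono dvd_imp_le)
  also have "\<dots> \<le> x" by fact
  finally have "ln (y ^ card Q) \<le> ln x" using y n by (subst ln_le_cancel_iff) auto
  thus ?thesis using y by (simp add: ln_realpow field_simps)
qed

lemma finite_primes_upto: "finite {p :: nat. prime p \<and> real p \<le> x}"
  by (rule finite_subset[of _ "{..nat \<lfloor>x\<rfloor>}"]) (auto simp: le_nat_floor)

text \<open>The pairs of such a prime \<open>p\<close> and a multiple \<open>n \<le> x\<close> are
  counted in two ways: each \<open>p\<close> has at least \<open>x / p - 1\<close> multiples, each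
  \<open>n\<close> at most \<open>ln x / ln y\<close> such divisors. The summand 1 in the bound pays
  for the subtracted ones, since at most \<open>x\<close> primes occur.\<close>

lemma sum_inverse_large_primes_le:
  fixes x y :: real
  assumes y: "y > 1" and x: "x \<ge> 1"
  shows "(\<Sum>p | prime p \<and> y < real p \<and> real p \<le> x. 1 / real p) \<le> ln x / ln y + 1"
proof -
  define Q where "Q = {p :: nat. prime p \<and> y < real p \<and> real p \<le> x}"
  define M where "M = nat \<lfloor>x\<rfloor>"
  have M: "real M \<le> x" using x by (simp add: M_def)
  have Qsub: "Q \<subseteq> {1..M}" using y by (auto simp: Q_def M_def le_nat_floor)
  have fin: "finite Q" by (rule finite_subset[OF Qsub]) auto
  have "card Q \<le> M" using card_mono[OF _ Qsub] by simp
  hence cQ: "real (card Q) \<le> x" using M by linarith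
  have "x * (\<Sum>p\<in>Q. 1 / real p) - real (card Q) = (\<Sum>p\<in>Q. x / real p - 1)"
    by (simp add: sum_subtractf sum_distrib_left)
  also have "\<dots> \<le> (\<Sum>p\<in>Q. real (M div p))"
  proof (rule sum_mono)
    fix p assume "p \<in> Q"
    thus "x / real p - 1 \<le> real (M div p)"
      using abs_floor_div_diff_le[of x p] x y by (auto simp: M_def Q_def abs_le_iff prime_gt_0_nat)
  qed
  also have "\<dots> = (\<Sum>p\<in>Q. \<Sum>n\<in>{1..M}. of_bool (p dvd n))"
  proof (rule sum.cong)
    fix p assume "p \<in> Q"
    hence "p > 0" by (auto simp: Q_def prime_gt_0_nat)
    thus "real (M div p) = (\<Sum>n\<in>{1..M}. of_bool (p dvd n))"
      using card_multiples_atLeastAtMost[of p M] by (simp add: Int_def)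
  qed simp
  also have "\<dots> = (\<Sum>n\<in>{1..M}. real (card {p \<in> Q. p dvd n}))"
    by (subst sum.swap) (simp add: fin Int_def)
  also have "\<dots> \<le> (\<Sum>n\<in>{1..M}. ln x / ln y)"
  proof (rule sum_mono)
    fix n assume "n \<in> {1..M}"
    thus "real (card {p \<in> Q. p dvd n}) \<le> ln x / ln y"
      using y M by (intro card_large_prime_divisors_le[of y n x]) (auto simp: Q_def)
  qed
  also have "\<dots> = real M * (ln x / ln y)" by simp
  also have "\<dots> \<le> x * (ln x / ln y)"
    using M x y by (intro mult_right_mono divide_nonneg_nonneg) auto
  finally have "x * (\<Sum>p\<in>Q. 1 / real p) \<le> x * (ln x / ln y + 1)"
    using cQ by (simp add: distrib_left)
  thus ?thesis using x by (simp add: Q_def)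
qed

lemma sum_inverse_squares_le:
  assumes "finite P" "0 \<notin> P"
  shows "(\<Sum>p\<in>P. 1 / real p ^ 2) \<le> 2"
proof -
  note s = suminf_inverse_squares_tail[of "\<lambda>n. 1 / real n ^ 2", simplified]
  have "(\<Sum>p\<in>P. 1 / real p ^ 2) \<le> (\<Sum>n. 1 / real n ^ 2)"
    using assms s(1) by (intro sum_le_suminf) auto
  also have "\<dots> \<le> 2" using s(2)[of 0] by (simp add: abs_le_iff)
  finally show ?thesis .
qed

lemma sum_primes_split:
  fixes f :: "nat \<Rightarrow> real"
  assumes "y \<le> x"
  shows "(\<Sum>p | prime p \<and> real p \<le> x. f p) = (\<Sum>p | prime p \<and> real p \<le> y. f p)
      + (\<Sum>p | prime p \<and> y < real p \<and> real p \<le> x. f p)"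
proof -
  have "{p :: nat. prime p \<and> real p \<le> x} = {p. prime p \<and> real p \<le> y} \<union> {p. prime p \<and> y < real p \<and> real p \<le> x}"
    using assms by auto
  thus ?thesis
    by (simp add: sum.union_disjoint[symmetric] finite_primes_upto disjoint_iff
          finite_subset[OF _ finite_primes_upto[of x]] Collect_mono)
qed

context
  fixes g :: "nat \<Rightarrow> real" and x y :: real
  assumes g: "\<And>p. prime p \<Longrightarrow> \<bar>g p\<bar> \<le> 1" and y: "1 < y" "y \<le> x"
begin

private lemma abs_sum_large_primes_le:
  assumes "\<And>p. prime p \<Longrightarrow> \<bar>f p\<bar> \<le> 1 / real p"
  shows "\<bar>\<Sum>p | prime p \<and> y < real p \<and> real p \<le> x. f p\<bar> \<le> ln x / ln y + 1"
proof -
  have "\<bar>\<Sum>p | prime p \<and> y < real p \<and> real p \<le> x. f p\<bar> \<le> (\<Sum>p | prime p \<and> y < real p \<and> real p \<le> x. 1 / real p)"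
    using assms by (intro order.trans[OF sum_abs] sum_mono) auto
  also have "\<dots> \<le> ln x / ln y + 1" using y by (intro sum_inverse_large_primes_le) auto
  finally show ?thesis .
qed

lemma prime_dev_sq: "(prime_dev g x)\<^sup>2 = (\<Sum>p | prime p \<and> real p \<le> x. (g p)\<^sup>2 / real p)"
  unfolding prime_dev_def by (intro real_sqrt_pow2 sum_nonneg) auto

text \<open>A draw of probability \<open>1 / (p + 1)\<close> has variance within
  \<open>2 / p\<^sup>2\<close> of \<open>1 / p\<close>, and the inverse squares sum to at most 2,
  which costs 4. The primes above \<open>y\<close> cost \<open>ln x / ln y + 1\<close>.\<close>

lemma truncated_variance_bound:
  "\<bar>(\<Sum>p | prime p \<and> real p \<le> y. (g p)\<^sup>2 * (1 / (real p + 1) * (1 - 1 / (real p + 1)))) - (prime_dev g x)\<^sup>2\<bar>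
    \<le> ln x / ln y + 5"
proof -
  let ?P = "{p :: nat. prime p \<and> real p \<le> y}"
  have g2: "(g p)\<^sup>2 \<le> 1" if "prime p" for p
    using g[OF that] by (simp add: abs_square_le_1)
  have "\<bar>(g p)\<^sup>2 / real p - (g p)\<^sup>2 * (1 / (real p + 1) * (1 - 1 / (real p + 1)))\<bar> \<le> 2 * (1 / real p ^ 2)"
    if "p \<in> ?P" for p
  proof -
    define r where "r = real p"
    have r: "r > 0" using that prime_gt_0_nat by (auto simp: r_def)
    have eq: "1 / r - 1 / (r + 1) * (1 - 1 / (r + 1)) = 1 / (r * (r + 1)) + 1 / (r + 1)\<^sup>2"
      using r by (simp add: divide_simps) (simp add: algebra_simps power2_eq_square)
    have "1 / (r * (r + 1)) \<le> 1 / r\<^sup>2" "1 / (r + 1)\<^sup>2 \<le> 1 / r\<^sup>2"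
      using r by (auto simp: power2_eq_square intro!: divide_left_mono mult_mono)
    moreover have "0 \<le> 1 / (r * (r + 1)) + 1 / (r + 1)\<^sup>2" using r by simp
    ultimately have *: "\<bar>1 / r - 1 / (r + 1) * (1 - 1 / (r + 1))\<bar> \<le> 2 * (1 / r\<^sup>2)" unfolding eq by linarith
    have "\<bar>(g p)\<^sup>2 / r - (g p)\<^sup>2 * (1 / (r + 1) * (1 - 1 / (r + 1)))\<bar>
        = (g p)\<^sup>2 * \<bar>1 / r - 1 / (r + 1) * (1 - 1 / (r + 1))\<bar>"
    proof -
      have "(g p)\<^sup>2 / r - (g p)\<^sup>2 * k = (g p)\<^sup>2 * (1 / r - k)" for k by (simp add: right_diff_distrib)
      thus ?thesis by (simp only: abs_mult abs_power2)
    qed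
    also have "\<dots> \<le> 1 * (2 * (1 / r\<^sup>2))"
      using g2[of p] that * by (intro mult_mono) auto
    finally show ?thesis by (simp add: r_def)
  qed
  hence "\<bar>\<Sum>p\<in>?P. (g p)\<^sup>2 / real p - (g p)\<^sup>2 * (1 / (real p + 1) * (1 - 1 / (real p + 1)))\<bar>
      \<le> (\<Sum>p\<in>?P. 2 * (1 / real p ^ 2))"
    by (intro order.trans[OF sum_abs] sum_mono)
  also have "\<dots> \<le> 2 * 2"
    unfolding sum_distrib_left[symmetric]
    by (intro mult_left_mono sum_inverse_squares_le finite_primes_upto) auto
  finally have 1: "\<bar>(\<Sum>p\<in>?P. (g p)\<^sup>2 / real p) - (\<Sum>p\<in>?P. (g p)\<^sup>2 * (1 / (real p + 1) * (1 - 1 / (real p + 1))))\<bar> \<le> 4"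
    by (simp add: sum_subtractf)
  have 2: "\<bar>\<Sum>p | prime p \<and> y < real p \<and> real p \<le> x. (g p)\<^sup>2 / real p\<bar> \<le> ln x / ln y + 1"
    using g2 by (intro abs_sum_large_primes_le) (auto intro: divide_right_mono)
  show ?thesis
    using 1 2 unfolding prime_dev_sq sum_primes_split[OF y(2)] by linarith
qed

text \<open>The bound holds for every single \<open>n\<close>, without an exceptional set. The
  primes above \<open>y\<close> enter once through the divisors of \<open>n\<close>, at most
  \<open>ln x / ln y\<close> of them, and once through the mean, at most
  \<open>ln x / ln y + 1\<close>. Replacing \<open>1 / p\<close> by \<open>1 / (p + 1)\<close> up to
  \<open>y\<close> costs 2.\<close>

lemma truncated_value_bound:
  assumes add: "additive_on_sqfree g" and n: "n \<in> sqfree_upto x"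
  shows "\<bar>(g n - prime_mean g x)
      - (sum g {p. prime p \<and> real p \<le> y \<and> p dvd n} - (\<Sum>p | prime p \<and> real p \<le> y. g p * (1 / (real p + 1))))\<bar>
    \<le> 2 * (ln x / ln y) + 3"
proof -
  let ?P = "{p :: nat. prime p \<and> real p \<le> y}"
  have sq: "squarefree n" "real n \<le> x"
    using n by (auto simp: sqfree_upto_def sqfree_nats_def)
  hence "n > 0" by (cases n) auto
  note sq = sq this
  let ?Q = "{p \<in> prime_factors n. y < real p}"
  have "g n = sum g (prime_factors n)" by (rule additive_on_sqfree_eq_sum[OF add sq(1)])
  also have "prime_factors n = {p. prime p \<and> real p \<le> y \<and> p dvd n} \<union> ?Q"
    using sq by (auto simp: in_prime_factors_iff)
  also have "sum g \<dots> = sum g {p. prime p \<and> real p \<le> y \<and> p dvd n} + sum g ?Q"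
    by (rule sum.union_disjoint) (auto intro: finite_subset[OF _ finite_primes_upto[of y]])
  finally have gn: "g n = \<dots>" .
  have "\<bar>sum g ?Q\<bar> \<le> (\<Sum>p\<in>?Q. 1)"
    using g by (intro order.trans[OF sum_abs] sum_mono) auto
  also have "\<dots> = real (card ?Q)" by simp
  also have "\<dots> \<le> ln x / ln y"
    using y sq by (intro card_large_prime_divisors_le[of y n x]) (auto simp: in_prime_factors_iff)
  finally have 1: "\<bar>sum g ?Q\<bar> \<le> ln x / ln y" .
  have 2: "\<bar>\<Sum>p | prime p \<and> y < real p \<and> real p \<le> x. g p / real p\<bar> \<le> ln x / ln y + 1"
    using g by (intro abs_sum_large_primes_le) (auto intro: divide_right_mono)
  have "\<bar>g p / real p - g p * (1 / (real p + 1))\<bar> \<le> 1 / real p ^ 2" if "p \<in> ?P" for p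
  proof -
    define r where "r = real p"
    have r: "r > 0" using that prime_gt_0_nat by (auto simp: r_def)
    have "g p / r - g p * (1 / (r + 1)) = g p * (1 / (r * (r + 1)))"
      using r by (simp add: field_simps)
    also have "\<bar>\<dots>\<bar> = \<bar>g p\<bar> * (1 / (r * (r + 1)))" using r by (simp add: abs_mult)
    also have "\<dots> \<le> 1 * (1 / r\<^sup>2)"
      using r g[of p] that by (intro mult_mono) (auto simp: power2_eq_square intro!: divide_left_mono)
    finally show ?thesis by (simp add: r_def)
  qed
  hence "\<bar>\<Sum>p\<in>?P. g p / real p - g p * (1 / (real p + 1))\<bar> \<le> (\<Sum>p\<in>?P. 1 / real p ^ 2)"
    by (intro order.trans[OF sum_abs] sum_mono)
  also have "\<dots> \<le> 2" by (intro sum_inverse_squares_le finite_primes_upto) auto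
  finally have 3: "\<bar>(\<Sum>p\<in>?P. g p / real p) - (\<Sum>p\<in>?P. g p * (1 / (real p + 1)))\<bar> \<le> 2"
    by (simp add: sum_subtractf)
  show ?thesis
    unfolding gn prime_mean_def sum_primes_split[OF y(2)] using 1 2 3 by linarith
qed

end

text \<open>The threshold makes the counting error \<open>3 * sqrt x\<close> at most half of the
  main term, so the denominator is at least \<open>sqfree_density * x / 2\<close>. \<open>C\<close>
  is chosen before \<open>x\<close> and \<open>D\<close>, which gives the uniformity over all small
  sets of primes.\<close>

lemma sqfree_multiples_frequency:
  "\<exists>C. \<forall>x\<ge>(6 / sqfree_density)\<^sup>2. \<forall>D. finite D \<longrightarrow> card D \<le> K \<longrightarrow> (\<forall>p\<in>D. prime p) \<longrightarrow>
     \<bar>real (card {n \<in> sqfree_upto x. \<forall>p\<in>D. p dvd n}) / real (card (sqfree_upto x)) - (\<Prod>p\<in>D. 1 / (real p + 1))\<bar>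
       \<le> C / sqrt x"
proof (intro exI allI impI)
  define c where "c = sqfree_density"
  have c: "c > 0" unfolding c_def by (rule sqfree_density_pos)
  fix x :: real and D :: "nat set"
  assume x: "x \<ge> (6 / sqfree_density)\<^sup>2" and D: "finite D" "card D \<le> K" "\<forall>p\<in>D. prime p"
  define N where "N = real (card (sqfree_upto x))"
  define R where "R = real (card {n \<in> sqfree_upto x. \<forall>p\<in>D. p dvd n})"
  define w where "w = (\<Prod>p\<in>D. 1 / (real p + 1))"
  have w: "0 \<le> w" "w \<le> 1" unfolding w_def by (auto intro!: prod_nonneg prod_le_1)
  have sx: "sqrt x \<ge> 6 / c" using x c by (intro real_le_rsqrt) (simp add: c_def)
  moreover have "6 / c > 0" using c by simp
  ultimately have sx0: "sqrt x > 0" by linarith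
  hence x0: "x > 0" by simp
  have xs: "x = sqrt x * sqrt x" using x0 by simp
  have NB: "\<bar>N - c * x\<bar> \<le> 3 * sqrt x" unfolding N_def c_def using x0 by (intro card_sqfree_upto_bound) simp
  have "3 * sqrt x \<le> (c / 2 * sqrt x) * sqrt x"
    using sx c sx0 by (intro mult_right_mono) (auto simp: field_simps)
  also have "\<dots> = c * x / 2" using xs by simp
  finally have N: "N \<ge> c * x / 2" using NB by linarith
  have cx: "c * x > 0" using c x0 by simp
  hence N0: "N > 0" using N by linarith
  have RB: "\<bar>R - c * x * w\<bar> \<le> (3 + c) * 3 ^ K * sqrt x"
  proof -
    have "\<bar>R - c * x * w\<bar> \<le> (3 + c) * 3 ^ card D * sqrt x"
      unfolding R_def c_def w_def using D x0 by (intro card_sqfree_upto_multiples_bound) auto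
    also have "\<dots> \<le> (3 + c) * 3 ^ K * sqrt x"
      using D c x0 by (intro mult_right_mono mult_left_mono power_increasing) auto
    finally show ?thesis .
  qed
  have "\<bar>w * (N - c * x)\<bar> \<le> 1 * (3 * sqrt x)"
    unfolding abs_mult using w NB by (intro mult_mono) auto
  hence "\<bar>R - w * N\<bar> \<le> ((3 + c) * 3 ^ K + 3) * sqrt x"
    using RB by (simp add: algebra_simps abs_le_iff)
  hence "\<bar>R / N - w\<bar> \<le> ((3 + c) * 3 ^ K + 3) * sqrt x / N"
    using N0 by (simp add: abs_le_iff field_simps)
  also have "\<dots> \<le> ((3 + c) * 3 ^ K + 3) * sqrt x / (c * x / 2)"
  proof (rule divide_left_mono[OF N])
    show "0 \<le> ((3 + c) * 3 ^ K + 3) * sqrt x" using c x0 by simp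
    show "0 < N * (c * x / 2)" using N0 cx by (intro mult_pos_pos) auto
  qed
  also have "\<dots> = (2 * ((3 + c) * 3 ^ K + 3) / c) / sqrt x"
  proof -
    have "a * s / (c * (s * s) / 2) = (2 * a / c) / s" if "s > 0" for a s
      using that c by (simp add: field_simps)
    from this[OF sx0] show ?thesis unfolding xs[symmetric] .
  qed
  finally show "\<bar>R / N - w\<bar> \<le> (2 * ((3 + c) * 3 ^ K + 3) / c) / sqrt x" .
qed

section \<open>Convergence to the normal distribution\<close>

lemma gauss_cdf_eq: "gauss_cdf z = cdf std_normal_distribution z"
proof -
  have "cdf std_normal_distribution z = (LINT w|std_normal_distribution. indicator {..z} w)"
    by (simp add: cdf_def)
  also have "\<dots> = (LINT w|lborel. std_normal_density w *\<^sub>R indicator {..z} w)"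
    by (rule integral_density) auto
  also have "\<dots> = (LINT w|lborel. 1 / sqrt (2 * pi) * (indicator {..z} w *\<^sub>R exp (- (w\<^sup>2 / 2))))"
    by (intro Bochner_Integration.integral_cong) (auto simp: std_normal_density_def)
  also have "\<dots> = gauss_cdf z"
    unfolding gauss_cdf_def set_lebesgue_integral_def by (rule integral_mult_right_zero)
  finally show ?thesis ..
qed

text \<open>Weak convergence controls distribution functions only at continuity points of the limit,
  so continuity is what admits every \<open>z\<close>.\<close>

lemma isCont_cdf_std_normal: "isCont (cdf std_normal_distribution) z"
proof -
  interpret real_distribution std_normal_distribution by (rule real_dist_normal_dist)
  have "emeasure std_normal_distribution {z} = 0"
    by (subst emeasure_density) (auto intro!: nn_integral_0_iff_AE[THEN iffD2] simp: AE_lborel_singleton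
        indicator_def eventually_mono[OF AE_lborel_singleton[of z]])
  thus ?thesis by (simp add: isCont_cdf measure_def)
qed

text \<open>Levy's theorem concerns sequences of measures, so the limit over real \<open>x\<close>
  is tested along an arbitrary sequence tending to infinity. Nonemptiness at every \<open>x\<close>
  lets \<open>pmf_of_set\<close> describe a uniform choice from \<open>S x\<close>.\<close>

lemma tendsto_gauss_cdf_of_char:
  fixes S :: "real \<Rightarrow> 'b set" and W :: "real \<Rightarrow> 'b \<Rightarrow> real"
  assumes S: "\<And>x. finite (S x)" "\<And>x. S x \<noteq> {}"
    and char: "\<And>t. ((\<lambda>x. (\<Sum>n\<in>S x. iexp (t * W x n)) / of_nat (card (S x)))
                 \<longlongrightarrow> of_real (exp (- (t\<^sup>2 / 2)))) at_top"
  shows "((\<lambda>x. real (card {n \<in> S x. W x n \<le> z}) / real (card (S x))) \<longlongrightarrow> gauss_cdf z) at_top"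
proof (rule tendsto_at_topI_sequentially)
  fix X :: "nat \<Rightarrow> real" assume X: "filterlim X at_top sequentially"
  define M where "M = (\<lambda>i. distr (measure_pmf (pmf_of_set (S (X i)))) borel (W (X i)))"
  have "weak_conv_m M std_normal_distribution"
  proof (rule levy_continuity)
    show "real_distribution (M i)" for i
      unfolding M_def by (rule prob_space.real_distribution_distr) (auto simp: measure_pmf.prob_space_axioms)
    show "real_distribution std_normal_distribution" by (rule real_dist_normal_dist)
    fix t
    have "char (M i) t = (\<Sum>n\<in>S (X i). iexp (t * W (X i) n)) / of_nat (card (S (X i)))" for i
    proof -
      have "char (M i) t = (CLINT n|measure_pmf (pmf_of_set (S (X i))). iexp (t * W (X i) n))"
        unfolding char_def M_def by (rule integral_distr) auto
      also have "\<dots> = (\<Sum>n\<in>S (X i). pmf (pmf_of_set (S (X i))) n *\<^sub>R iexp (t * W (X i) n))"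
        using S by (intro integral_measure_pmf) auto
      also have "\<dots> = (\<Sum>n\<in>S (X i). iexp (t * W (X i) n)) / of_nat (card (S (X i)))"
        using S by (simp add: sum_divide_distrib scaleR_conv_of_real)
      finally show ?thesis .
    qed
    moreover have "char std_normal_distribution t = of_real (exp (- (t\<^sup>2 / 2)))"
      by (simp add: char_std_normal_distribution)
    ultimately show "(\<lambda>i. char (M i) t) \<longlonglongrightarrow> char std_normal_distribution t"
      using filterlim_compose[OF char[of t] X] by simp
  qed
  hence "(\<lambda>i. cdf (M i) z) \<longlonglongrightarrow> gauss_cdf z"
    unfolding weak_conv_m_def weak_conv_def gauss_cdf_eq using isCont_cdf_std_normal by blast
  moreover have "cdf (M i) z = real (card {n \<in> S (X i). W (X i) n \<le> z}) / real (card (S (X i)))" for i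
  proof -
    have "cdf (M i) z = measure (measure_pmf (pmf_of_set (S (X i)))) (W (X i) -` {..z})"
      unfolding M_def cdf_def by (subst measure_distr) auto
    also have "\<dots> = real (card (S (X i) \<inter> W (X i) -` {..z})) / real (card (S (X i)))"
      using S by (intro measure_pmf_of_set)
    also have "S (X i) \<inter> W (X i) -` {..z} = {n \<in> S (X i). W (X i) n \<le> z}" by auto
    finally show ?thesis .
  qed
  ultimately show "(\<lambda>i. real (card {n \<in> S (X i). W (X i) n \<le> z}) / real (card (S (X i)))) \<longlonglongrightarrow> gauss_cdf z"
    by simp
qed

lemma cmod_iexp_diff_le: "cmod (iexp a - iexp b) \<le> \<bar>a - b\<bar>"
proof -
  have "iexp a - iexp b = iexp b * (iexp (a - b) - 1)"
    by (simp add: algebra_simps flip: exp_add)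
  also have "cmod \<dots> = cmod (iexp (a - b) - 1)" by (simp add: norm_mult)
  also have "\<dots> \<le> \<bar>a - b\<bar>" using iexp_approx1[of "a - b" 0] by simp
  finally show ?thesis .
qed

section \<open>The truncated statistic and its characteristic function\<close>

abbreviation (input) lnlnln :: "real \<Rightarrow> real" where "lnlnln x \<equiv> ln (ln (ln x))"

definition cutoff :: "real \<Rightarrow> real" where
  "cutoff x = x powr (1 / lnlnln x)"

definition small_primes :: "real \<Rightarrow> nat set" where
  "small_primes x = {p. prime p \<and> real p \<le> cutoff x}"

definition trunc_var :: "(nat \<Rightarrow> real) \<Rightarrow> real \<Rightarrow> real" where
  "trunc_var g x = (\<Sum>p\<in>small_primes x. (g p / prime_dev g x)\<^sup>2 * (1 / (real p + 1) * (1 - 1 / (real p + 1))))"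

text \<open>Centring with \<open>1 / (p + 1)\<close> instead of \<open>1 / p\<close> subtracts
  exactly the mean of the independent model, as \<open>empirical_char_bound\<close> requires.
  Dividing by the full \<open>prime_dev\<close> makes the variance condition there hold with bound
  1.\<close>

definition trunc_val :: "(nat \<Rightarrow> real) \<Rightarrow> real \<Rightarrow> nat \<Rightarrow> real" where
  "trunc_val g x n = (\<Sum>p | p \<in> small_primes x \<and> p dvd n. g p / prime_dev g x)
      - (\<Sum>p\<in>small_primes x. g p / prime_dev g x * (1 / (real p + 1)))"

definition charfn :: "(real \<Rightarrow> nat \<Rightarrow> real) \<Rightarrow> real \<Rightarrow> real \<Rightarrow> complex" where
  "charfn W t x = (\<Sum>n\<in>sqfree_upto x. iexp (t * W x n)) / of_nat (card (sqfree_upto x))"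

context
  fixes g :: "nat \<Rightarrow> real"
  assumes add: "additive_on_sqfree g"
    and g: "\<And>p. prime p \<Longrightarrow> \<bar>g p\<bar> \<le> 1"
    and growth: "filterlim (\<lambda>x. prime_dev g x / ln (ln (ln x))) at_top at_top"
begin

lemma eventually_cutoff:
  "\<forall>\<^sub>F x in at_top. 1 < cutoff x \<and> cutoff x \<le> x \<and> ln x / ln (cutoff x) = lnlnln x \<and> 1 \<le> lnlnln x"
proof -
  have "\<forall>\<^sub>F x in at_top. 1 < cutoff x" unfolding cutoff_def by real_asymp
  moreover have "\<forall>\<^sub>F x in at_top. cutoff x \<le> x" unfolding cutoff_def by real_asymp
  moreover have "\<forall>\<^sub>F x::real in at_top. 1 \<le> lnlnln x" by real_asymp
  moreover have "\<forall>\<^sub>F x::real in at_top. 1 < x" by real_asymp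
  ultimately show ?thesis
    by eventually_elim (auto simp: cutoff_def ln_powr)
qed

lemma prime_dev_at_top: "filterlim (prime_dev g) at_top at_top"
proof -
  have "filterlim (\<lambda>x::real. lnlnln x) at_top at_top" by real_asymp
  from filterlim_at_top_mult_at_top[OF growth this]
  show ?thesis
  proof (rule filterlim_mono_eventually)
    show "\<forall>\<^sub>F x in at_top. prime_dev g x / lnlnln x * lnlnln x = prime_dev g x"
      using eventually_cutoff by eventually_elim auto
  qed auto
qed

lemma lnlnln_div_prime_dev: "((\<lambda>x. lnlnln x / prime_dev g x) \<longlongrightarrow> 0) at_top"
  using tendsto_inverse_0_at_top[OF growth] by simp

lemma inverse_prime_dev: "((\<lambda>x. 1 / prime_dev g x) \<longlongrightarrow> 0) at_top"
  using tendsto_inverse_0_at_top[OF prime_dev_at_top] by (simp add: inverse_eq_divide)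

lemma finite_small_primes: "finite (small_primes x)"
  unfolding small_primes_def by (rule finite_primes_upto)

text \<open>Truncation changes the variance before normalisation by at most
  \<open>lnlnln x + 5\<close>, which is negligible against
  \<open>(prime_dev g x)\<^sup>2\<close>.\<close>

lemma trunc_var_tendsto: "(trunc_var g \<longlongrightarrow> 1) at_top"
proof (rule Lim_transform[OF tendsto_const])
  have "((\<lambda>x. (lnlnln x / prime_dev g x + 5 * (1 / prime_dev g x)) * (1 / prime_dev g x)) \<longlongrightarrow> (0 + 5 * 0) * 0) at_top"
    by (intro tendsto_intros lnlnln_div_prime_dev inverse_prime_dev)
  hence lim: "((\<lambda>x. (lnlnln x / prime_dev g x + 5 * (1 / prime_dev g x)) * (1 / prime_dev g x)) \<longlongrightarrow> 0) at_top"
    by simp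
  show "((\<lambda>x. trunc_var g x - 1) \<longlongrightarrow> 0) at_top"
  proof (rule tendsto_0_le[OF lim, where K = 1])
    show "\<forall>\<^sub>F x in at_top. norm (trunc_var g x - 1)
        \<le> norm ((lnlnln x / prime_dev g x + 5 * (1 / prime_dev g x)) * (1 / prime_dev g x)) * 1"
      using eventually_cutoff filterlim_at_top_dense[THEN iffD1, OF prime_dev_at_top, rule_format, of 0]
    proof eventually_elim
      case (elim x)
      define B where "B = prime_dev g x"
      define S where "S = (\<Sum>p | prime p \<and> real p \<le> cutoff x. (g p)\<^sup>2 * (1 / (real p + 1) * (1 - 1 / (real p + 1))))"
      have B: "B > 0" using elim by (simp add: B_def)
      have V: "trunc_var g x = S / B\<^sup>2"
        by (simp add: trunc_var_def S_def small_primes_def B_def sum_divide_distrib power_divide mult.commute)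
      have "\<bar>S - B\<^sup>2\<bar> \<le> lnlnln x + 5"
        unfolding S_def B_def using truncated_variance_bound[of g "cutoff x" x] elim g by simp
      hence "\<bar>S - B\<^sup>2\<bar> / B\<^sup>2 \<le> (lnlnln x + 5) / B\<^sup>2" using B by (intro divide_right_mono) auto
      also have "\<dots> = (lnlnln x / B + 5 * (1 / B)) * (1 / B)"
        using B by (simp add: field_simps power2_eq_square)
      also have "\<bar>S - B\<^sup>2\<bar> / B\<^sup>2 = \<bar>(S - B\<^sup>2) / B\<^sup>2\<bar>" by simp
      also have "(S - B\<^sup>2) / B\<^sup>2 = S / B\<^sup>2 - 1" using B by (simp add: diff_divide_distrib)
      finally have "\<bar>S / B\<^sup>2 - 1\<bar> \<le> \<bar>(lnlnln x / B + 5 * (1 / B)) * (1 / B)\<bar>"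
        by (metis abs_ge_self order.trans)
      thus ?case unfolding V B_def[symmetric] by simp
    qed
  qed
qed

text \<open>\<open>h\<close> collects everything that vanishes for fixed \<open>m\<close>; the other
  summand is the Taylor tail, which is free of \<open>x\<close> and left to a later choice of
  \<open>m\<close>.\<close>

lemma charfn_trunc_bound:
  assumes m: "m \<ge> 1"
  shows "\<exists>h. (h \<longlongrightarrow> 0) at_top \<and> (\<forall>\<^sub>F x in at_top.
      cmod (charfn (trunc_val g) t x - of_real (exp (- (t\<^sup>2 * trunc_var g x / 2)))) \<le> h x + 4 * (1 / 4) ^ m * exp (4 * t\<^sup>2))"
proof -
  obtain C where C: "\<And>x D. x \<ge> (6 / sqfree_density)\<^sup>2 \<Longrightarrow> finite D \<Longrightarrow> card D \<le> 2 * m \<Longrightarrow> (\<forall>p\<in>D. prime p) \<Longrightarrow>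
     \<bar>real (card {n \<in> sqfree_upto x. \<forall>p\<in>D. p dvd n}) / real (card (sqfree_upto x)) - (\<Prod>p\<in>D. 1 / (real p + 1))\<bar>
       \<le> C / sqrt x"
    using sqfree_multiples_frequency[of "2 * m"] by blast
  define h where "h = (\<lambda>x. (2 * cutoff x) ^ (2 * m) * (C / sqrt x) * exp \<bar>t\<bar>
      + \<bar>t\<bar> ^ 3 * (1 / prime_dev g x) + t ^ 4 * (1 / prime_dev g x)\<^sup>2)"
  \<comment> \<open>This is a constant times \<open>x powr (2 * m / lnlnln x - 1 / 2)\<close>, whose
    exponent tends to \<open>- 1 / 2\<close>.\<close>
  have "((\<lambda>x::real. (2 * cutoff x) ^ (2 * m) * (C / sqrt x)) \<longlongrightarrow> 0) at_top"
    unfolding cutoff_def by real_asymp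
  hence "(h \<longlongrightarrow> 0 * exp \<bar>t\<bar> + \<bar>t\<bar> ^ 3 * 0 + t ^ 4 * 0\<^sup>2) at_top"
    unfolding h_def by (intro tendsto_intros inverse_prime_dev)
  hence h: "(h \<longlongrightarrow> 0) at_top" by simp
  have "\<forall>\<^sub>F x in at_top. cmod (charfn (trunc_val g) t x - of_real (exp (- (t\<^sup>2 * trunc_var g x / 2))))
      \<le> h x + 4 * (1 / 4) ^ m * exp (4 * t\<^sup>2)"
    using eventually_cutoff eventually_ge_at_top[of "(6 / sqfree_density)\<^sup>2"]
      filterlim_at_top_dense[THEN iffD1, OF prime_dev_at_top, rule_format, of "max 1 (2 * \<bar>t\<bar>)"]
  proof eventually_elim
    case (elim x)
    define B where "B = prime_dev g x"
    \<comment> \<open>With \<open>\<beta> = 1 / B\<close>, the second bound yields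
      \<open>2 * \<bar>t\<bar> * \<beta> \<le> 1\<close>. The first makes every coefficient at most
      1 in absolute value, so that their sum is at most the number of small primes and
      \<open>Y = cutoff x\<close> works.\<close>
    have B: "B > 1" "B > 2 * \<bar>t\<bar>" using elim by (auto simp: B_def)
    have prm: "prime p" if "p \<in> small_primes x" for p using that by (simp add: small_primes_def)
    have "cmod ((\<Sum>n\<in>sqfree_upto x. iexp (t * (sum (\<lambda>p. g p / B) {p. p \<in> small_primes x \<and> p dvd n}
            - (\<Sum>p\<in>small_primes x. g p / B * (1 / (real p + 1)))))) / of_nat (card (sqfree_upto x))
        - of_real (exp (- (t\<^sup>2 * (\<Sum>p\<in>small_primes x. (g p / B)\<^sup>2 * (1 / (real p + 1) * (1 - 1 / (real p + 1)))) / 2))))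
      \<le> (2 * cutoff x) ^ (2 * m) * (C / sqrt x) * exp \<bar>t\<bar> + 4 * (1 / 4) ^ m * exp (4 * t\<^sup>2) + \<bar>t\<bar> ^ 3 * (1 / B) + t ^ 4 * (1 / B)\<^sup>2"
    proof (rule empirical_char_bound)
      show "finite (small_primes x)" by (rule finite_small_primes)
      show "finite (sqfree_upto x)" by (rule finite_sqfree_upto)
      have "1 \<in> sqfree_upto x" using elim by (auto simp: sqfree_upto_def sqfree_nats_def)
      thus "sqfree_upto x \<noteq> {}" by blast
      show "{p. p \<in> small_primes x \<and> p dvd n} \<subseteq> small_primes x" for n by auto
      show "0 \<le> 1 / (real p + 1) \<and> 1 / (real p + 1) \<le> 1" for p by simp
      show cB: "\<bar>g p / B\<bar> \<le> 1 / B" if "p \<in> small_primes x" for p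
        using g[OF prm[OF that]] B by (simp add: divide_right_mono)
      show "0 \<le> 1 / B" "2 * \<bar>t\<bar> * (1 / B) \<le> 1" using B by (auto simp: field_simps)
      show "(\<Sum>p\<in>small_primes x. (g p / B)\<^sup>2 * (1 / (real p + 1))) \<le> 1"
      proof -
        have "(\<Sum>p\<in>small_primes x. (g p / B)\<^sup>2 * (1 / (real p + 1))) = (\<Sum>p\<in>small_primes x. (g p)\<^sup>2 * (1 / (real p + 1))) / B\<^sup>2"
          by (simp add: sum_divide_distrib power_divide field_simps)
        also have "(\<Sum>p\<in>small_primes x. (g p)\<^sup>2 * (1 / (real p + 1))) \<le> (\<Sum>p\<in>small_primes x. (g p)\<^sup>2 / real p)"
          using prm by (intro sum_mono) (auto intro!: divide_left_mono simp: prime_gt_0_nat)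
        also have "\<dots> \<le> (\<Sum>p | prime p \<and> real p \<le> x. (g p)\<^sup>2 / real p)"
          using elim by (intro sum_mono2 finite_primes_upto) (auto simp: small_primes_def)
        also have "\<dots> = B\<^sup>2" unfolding B_def by (subst prime_dev_sq[of g "cutoff x"]) (use elim g in auto)
        finally show ?thesis using B by (simp add: divide_right_mono)
      qed
      show "(\<Sum>p\<in>small_primes x. \<bar>g p / B\<bar>) \<le> cutoff x"
      proof -
        have "\<bar>g p / B\<bar> \<le> 1" if "p \<in> small_primes x" for p
        proof -
          have "1 / B \<le> 1" using B by simp
          with cB[OF that] show ?thesis by linarith
        qed
        hence "(\<Sum>p\<in>small_primes x. \<bar>g p / B\<bar>) \<le> (\<Sum>p\<in>small_primes x. 1)" by (intro sum_mono)
        also have "\<dots> = real (card (small_primes x))" by simp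
        also have "card (small_primes x) \<le> card {1..nat \<lfloor>cutoff x\<rfloor>}"
          by (intro card_mono) (auto simp: small_primes_def le_nat_floor Suc_le_eq prime_gt_0_nat)
        also have "real (card {1..nat \<lfloor>cutoff x\<rfloor>}) \<le> cutoff x" using elim by simp
        finally show ?thesis by simp
      qed
      show "1 \<le> cutoff x" using elim by simp
      show "1 \<le> m" by (rule m)
      fix D assume D: "D \<subseteq> small_primes x" "card D \<le> 2 * m"
      have "{n \<in> sqfree_upto x. D \<subseteq> {p. p \<in> small_primes x \<and> p dvd n}} = {n \<in> sqfree_upto x. \<forall>p\<in>D. p dvd n}"
        using D by auto
      thus "\<bar>real (card {n \<in> sqfree_upto x. D \<subseteq> {p. p \<in> small_primes x \<and> p dvd n}}) / real (card (sqfree_upto x))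
          - (\<Prod>p\<in>D. 1 / (real p + 1))\<bar> \<le> C / sqrt x"
        using D elim prm by (simp only:) (intro C, auto intro: finite_subset[OF _ finite_small_primes])
    qed
    thus ?case
      by (simp add: charfn_def trunc_val_def trunc_var_def h_def B_def add_ac)
  qed
  with h show ?thesis by blast
qed

text \<open>The order of choices matters: \<open>m\<close> is fixed first, with the tail below
  \<open>e / 2\<close>, and only then does \<open>x\<close> grow until \<open>h\<close> is below
  \<open>e / 2\<close>.\<close>

lemma charfn_trunc_tendsto:
  "((\<lambda>x. charfn (trunc_val g) t x - of_real (exp (- (t\<^sup>2 * trunc_var g x / 2)))) \<longlongrightarrow> 0) at_top"
proof (rule tendstoI)
  fix e :: real assume e: "e > 0"
  have lim: "(\<lambda>m. 4 * (1 / 4) ^ m * exp (4 * t\<^sup>2)) \<longlonglongrightarrow> 4 * 0 * exp (4 * t\<^sup>2)"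
    by (intro tendsto_intros LIMSEQ_realpow_zero) auto
  have "\<forall>\<^sub>F m in sequentially. 4 * (1 / 4) ^ m * exp (4 * t\<^sup>2) < e / 2"
    using e by (intro order_tendstoD(2)[OF lim]) auto
  hence "\<forall>\<^sub>F m in sequentially. 4 * (1 / 4) ^ m * exp (4 * t\<^sup>2) < e / 2 \<and> m \<ge> 1"
    using eventually_ge_at_top by (rule eventually_conj)
  then obtain m where m: "4 * (1 / 4) ^ m * exp (4 * t\<^sup>2) < e / 2" "m \<ge> 1"
    by (auto simp: eventually_sequentially)
  obtain h where h: "(h \<longlongrightarrow> 0) at_top" "\<forall>\<^sub>F x in at_top.
      cmod (charfn (trunc_val g) t x - of_real (exp (- (t\<^sup>2 * trunc_var g x / 2)))) \<le> h x + 4 * (1 / 4) ^ m * exp (4 * t\<^sup>2)"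
    using charfn_trunc_bound[OF m(2), of t] by blast
  have "\<forall>\<^sub>F x in at_top. h x < e / 2" using h(1) e by (intro order_tendstoD) auto
  with h(2) show "\<forall>\<^sub>F x in at_top. dist (charfn (trunc_val g) t x - of_real (exp (- (t\<^sup>2 * trunc_var g x / 2)))) 0 < e"
    by eventually_elim (use m in \<open>simp add: dist_norm\<close>)
qed

text \<open>\<open>iexp\<close> is Lipschitz with constant 1, so the pointwise error
  \<open>(2 * lnlnln x + 3) / prime_dev g x\<close> passes to the averages with a factor
  \<open>\<bar>t\<bar>\<close>. The growth hypothesis enters here as
  \<open>lnlnln x = o(prime_dev g x)\<close>.\<close>

lemma charfn_diff_tendsto:
  "((\<lambda>x. charfn (\<lambda>x n. (g n - prime_mean g x) / prime_dev g x) t x - charfn (trunc_val g) t x) \<longlongrightarrow> 0) at_top"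
proof -
  have "((\<lambda>x. \<bar>t\<bar> * (2 * (lnlnln x / prime_dev g x) + 3 * (1 / prime_dev g x))) \<longlongrightarrow> \<bar>t\<bar> * (2 * 0 + 3 * 0)) at_top"
    by (intro tendsto_intros lnlnln_div_prime_dev inverse_prime_dev)
  hence lim: "((\<lambda>x. \<bar>t\<bar> * (2 * (lnlnln x / prime_dev g x) + 3 * (1 / prime_dev g x))) \<longlongrightarrow> 0) at_top" by simp
  show ?thesis
  proof (rule tendsto_0_le[OF lim, where K = 1])
    show "\<forall>\<^sub>F x in at_top. norm (charfn (\<lambda>x n. (g n - prime_mean g x) / prime_dev g x) t x - charfn (trunc_val g) t x)
        \<le> norm (\<bar>t\<bar> * (2 * (lnlnln x / prime_dev g x) + 3 * (1 / prime_dev g x))) * 1"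
      using eventually_cutoff filterlim_at_top_dense[THEN iffD1, OF prime_dev_at_top, rule_format, of 0]
    proof eventually_elim
      case (elim x)
      define B where "B = prime_dev g x"
      have B: "B > 0" using elim by (simp add: B_def)
      define W where "W = (\<lambda>n. (g n - prime_mean g x) / B)"
      define b where "b = \<bar>t\<bar> * (2 * (lnlnln x / B) + 3 * (1 / B))"
      have b0: "b \<ge> 0" using B elim by (simp add: b_def)
      have d: "cmod (iexp (t * W n) - iexp (t * trunc_val g x n)) \<le> b" if n: "n \<in> sqfree_upto x" for n
      proof -
        have eq: "trunc_val g x n = (sum g {p. prime p \<and> real p \<le> cutoff x \<and> p dvd n}
            - (\<Sum>p | prime p \<and> real p \<le> cutoff x. g p * (1 / (real p + 1)))) / B"
          by (simp add: trunc_val_def small_primes_def B_def sum_divide_distrib diff_divide_distrib conj_assoc mult.commute)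
        have "\<bar>W n - trunc_val g x n\<bar> \<le> (2 * lnlnln x + 3) / B"
          unfolding W_def eq diff_divide_distrib[symmetric] abs_divide
          using truncated_value_bound[of g "cutoff x" x n] elim g add n B
          by (simp add: divide_right_mono)
        hence "\<bar>t\<bar> * \<bar>W n - trunc_val g x n\<bar> \<le> \<bar>t\<bar> * ((2 * lnlnln x + 3) / B)" by (rule mult_left_mono) simp
        moreover have "cmod (iexp (t * W n) - iexp (t * trunc_val g x n)) \<le> \<bar>t\<bar> * \<bar>W n - trunc_val g x n\<bar>"
          using cmod_iexp_diff_le[of "t * W n" "t * trunc_val g x n"] by (simp add: abs_mult flip: right_diff_distrib)
        ultimately show ?thesis by (simp add: b_def add_divide_distrib)
      qed
      define N where "N = card (sqfree_upto x)"
      have "cmod ((\<Sum>n\<in>sqfree_upto x. iexp (t * W n) - iexp (t * trunc_val g x n)) / of_nat N)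
          \<le> real N * b / real N"
        unfolding norm_divide norm_of_nat N_def using d
        by (intro divide_right_mono order.trans[OF norm_sum]) (auto intro: sum_bounded_above)
      also have "\<dots> \<le> b" using b0 by simp
      finally show ?case
        using b0 by (simp add: charfn_def W_def b_def B_def N_def sum_subtractf diff_divide_distrib)
    qed
  qed
qed

lemma charfn_tendsto:
  "((\<lambda>x. charfn (\<lambda>x n. (g n - prime_mean g x) / prime_dev g x) t x) \<longlongrightarrow> of_real (exp (- (t\<^sup>2 / 2)))) at_top"
proof -
  have "((\<lambda>x. complex_of_real (exp (- (t\<^sup>2 * trunc_var g x / 2)))) \<longlongrightarrow> of_real (exp (- (t\<^sup>2 * 1 / 2)))) at_top"
    by (intro tendsto_intros trunc_var_tendsto) auto
  from tendsto_add[OF tendsto_add[OF charfn_diff_tendsto[of t] charfn_trunc_tendsto[of t]] this]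
  show ?thesis by simp
qed

end

theorem theorem4p2:
  fixes g :: "nat \<Rightarrow> real" and z :: real
  assumes "additive_on_sqfree g"
    and "\<And>p::nat. prime p \<Longrightarrow> \<bar>g p\<bar> \<le> 1"
    and "filterlim (\<lambda>x::real. prime_dev g x / ln (ln (ln x))) at_top at_top"
  shows "((\<lambda>x::real.
            real (card {n \<in> sqfree_upto x. g n - prime_mean g x \<le> z * prime_dev g x})
              / real (card (sqfree_upto x)))
          \<longlongrightarrow> gauss_cdf z) at_top"
proof -
  have dev: "filterlim (prime_dev g) at_top at_top" using assms by (rule prime_dev_at_top)
  have char: "((\<lambda>x. charfn (\<lambda>x n. (g n - prime_mean g x) / prime_dev g x) t x)
      \<longlongrightarrow> of_real (exp (- (t\<^sup>2 / 2)))) at_top" for t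
    using assms by (rule charfn_tendsto)
  \<comment> \<open>\<open>max 1 x\<close> keeps 1 in the set for every real \<open>x\<close> and
    changes nothing once \<open>x \<ge> 1\<close>.\<close>
  let ?S = "\<lambda>x::real. sqfree_upto (max 1 x)"
  let ?W = "\<lambda>x n. (g n - prime_mean g x) / prime_dev g x"
  have "((\<lambda>x. real (card {n \<in> ?S x. ?W x n \<le> z}) / real (card (?S x))) \<longlongrightarrow> gauss_cdf z) at_top"
  proof (rule tendsto_gauss_cdf_of_char)
    have "1 \<in> ?S x" for x by (simp add: sqfree_upto_def sqfree_nats_def)
    thus "?S x \<noteq> {}" for x by blast
    fix t
    have "\<forall>\<^sub>F x in at_top. charfn ?W t x = (\<Sum>n\<in>?S x. iexp (t * ?W x n)) / of_nat (card (?S x))"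
      using eventually_ge_at_top[of 1] by eventually_elim (simp only: charfn_def max_absorb2)
    thus "((\<lambda>x. (\<Sum>n\<in>?S x. iexp (t * ?W x n)) / of_nat (card (?S x))) \<longlongrightarrow> of_real (exp (- (t\<^sup>2 / 2)))) at_top"
      using char[of t] by (rule Lim_transform_eventually[rotated])
  qed (rule finite_sqfree_upto)
  moreover have "\<forall>\<^sub>F x in at_top. real (card {n \<in> ?S x. ?W x n \<le> z}) / real (card (?S x))
      = real (card {n \<in> sqfree_upto x. g n - prime_mean g x \<le> z * prime_dev g x}) / real (card (sqfree_upto x))"
    using eventually_ge_at_top[of 1] filterlim_at_top_dense[THEN iffD1, OF dev, rule_format, of 0]
    by eventually_elim (simp add: max_def pos_divide_le_eq)
  ultimately show ?thesis by (rule Lim_transform_eventually)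
qed

end
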